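(* Suppose $(P,\leq_P)$ is a locally countable Borel partial order of size continuum, $Q$ is an uncountable, countably directed Borel subset of $P$, and $x$ is an element of $P$ which is not below any element of $Q$. Then $P$ has no Borel embedding into Turing reducibility.
   Context: A Borel partial order is a partial order $(P,\leq_P)$ with $P$ a Borel subset of $2^\omega$ and $\leq_P$ a Borel subset of $2^\omega\times 2^\omega$; it is locally countable if every element has at most countably many strict predecessors. A subset $Q\subseteq P$ is countably directed if every countable subset of $Q$ has an upper bound in $Q$. A Borel embedding of $P$ into Turing reducibility is a Borel function $f\colon P\to 2^\omega$ with $a\leq_P b\iff f(a)\leq_T f(b)$ for all $a,b\in P$. *)

theory Defs
  imports "HOL-Analysis.Analysis" "HOL-Library.Equipollence"
begin

text \<open>Cantor space: the type nat \<Rightarrow> bool with the product topology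
  (bool carries the discrete topology). Borel sets are those of the Borel sigma-algebra.\<close>

type_synonym cantor = "nat \<Rightarrow> bool"

definition borel_set :: "cantor set \<Rightarrow> bool" where
  "borel_set A \<longleftrightarrow> A \<in> sets (borel :: cantor measure)"

definition borel_set2 :: "(cantor \<times> cantor) set \<Rightarrow> bool" where
  "borel_set2 R \<longleftrightarrow> R \<in> sets (borel :: (cantor \<times> cantor) measure)"

definition borel_fun_on :: "cantor set \<Rightarrow> (cantor \<Rightarrow> cantor) \<Rightarrow> bool" where
  "borel_fun_on P f \<longleftrightarrow> f \<in> borel_measurable (restrict_space borel P)"

text \<open>Functions nat list \<Rightarrow> nat (of a given arity) that are general recursive
  relative to a function g (Kleene: zero, successor, projections, the function g, composition,
  primitive recursion, and minimisation of regular functions).\<close>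
inductive rec_in :: "(nat \<Rightarrow> nat) \<Rightarrow> nat \<Rightarrow> (nat list \<Rightarrow> nat) \<Rightarrow> bool" for g where
  zero: "rec_in g n (\<lambda>xs. 0)"
| succ: "rec_in g 1 (\<lambda>xs. Suc (hd xs))"
| proj: "i < n \<Longrightarrow> rec_in g n (\<lambda>xs. xs ! i)"
| orac: "rec_in g 1 (\<lambda>xs. g (hd xs))"
| comp: "rec_in g m f \<Longrightarrow> length hs = m \<Longrightarrow> (\<forall>h\<in>set hs. rec_in g n h) \<Longrightarrow>
         rec_in g n (\<lambda>xs. f (map (\<lambda>h. h xs) hs))"
| prim: "rec_in g n b \<Longrightarrow> rec_in g (Suc (Suc n)) s \<Longrightarrow>
         rec_in g (Suc n) (\<lambda>xs. rec_nat (b (tl xs)) (\<lambda>y r. s (y # r # tl xs)) (hd xs))"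
| mu: "rec_in g (Suc n) f \<Longrightarrow> (\<forall>xs. length xs = n \<longrightarrow> (\<exists>y. f (y # xs) = 0)) \<Longrightarrow>
       rec_in g n (\<lambda>xs. LEAST y. f (y # xs) = 0)"

definition char_fun :: "cantor \<Rightarrow> nat \<Rightarrow> nat" where
  "char_fun A n = (if A n then 1 else 0)"

definition turing_le :: "cantor \<Rightarrow> cantor \<Rightarrow> bool" where
  "turing_le A B \<longleftrightarrow> (\<exists>f. rec_in (char_fun B) 1 f \<and> (\<forall>n. f [n] = char_fun A n))"

definition locally_countable :: "cantor set \<Rightarrow> (cantor \<times> cantor) set \<Rightarrow> bool" where
  "locally_countable P R \<longleftrightarrow> (\<forall>b\<in>P. countable {a\<in>P. (a, b) \<in> R \<and> a \<noteq> b})"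

definition countably_directed :: "(cantor \<times> cantor) set \<Rightarrow> cantor set \<Rightarrow> bool" where
  "countably_directed R Q \<longleftrightarrow>
     (\<forall>C. C \<subseteq> Q \<longrightarrow> countable C \<longrightarrow> (\<exists>u\<in>Q. \<forall>c\<in>C. (c, u) \<in> R))"

end

theory Submission
  imports Defs "HOL-Library.Nat_Bijection" "HOL-Probability.Discrete_Topology"
begin

text \<open>
  The image \<open>A = f ` Q\<close> is an uncountable analytic set which is countably directed under Turing
  reducibility, and every real \<open>z\<close> lies below some element of such a set; for \<open>z = f x\<close> this puts
  \<open>x\<close> below an element of \<open>Q\<close>.

  To find the element, write \<open>A\<close> as a continuous image of a closed subset of a Polish space, restrict
  to condensation points, and let \<open>B\<close> be the image of a countable dense set of them. Pick \<open>c\<close> in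
  \<open>A\<close> computing every element of \<open>B\<close>. One builds four reals in \<open>A\<close>, each a limit of elements of
  \<open>B\<close>. At every stage one of them leaves the element of \<open>B\<close> it has been following, at a position
  \<open>k\<close>; it is one of the two that did not leave at the last two stages, and which of the two it is
  records a bit of \<open>z\<close>. Since \<open>k\<close> can be taken as large as desired, the position of the next
  departure bounds a \<open>c\<close>-index of the element that a departed real follows now, and the position after
  that is long enough to index_test all wrong indices below the bound. So the four reals together with
  \<open>c\<close> compute \<open>z\<close>, and so does every upper bound of these five reals in \<open>A\<close>.
\<close>

section \<open>Relative computability\<close>

text \<open>The predicate \<open>rec_in\<close> sees the values of a function on lists of the wrong length, such as
  those given by \<open>hd []\<close>; this relaxation ignores them.\<close>

definition rec_fun_on :: "(nat \<Rightarrow> nat) \<Rightarrow> nat \<Rightarrow> (nat list \<Rightarrow> nat) \<Rightarrow> bool" where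
  "rec_fun_on g n f \<longleftrightarrow> (\<exists>F. rec_in g n F \<and> (\<forall>xs. length xs = n \<longrightarrow> F xs = f xs))"

lemma rec_fun_on_cong:
  assumes "rec_fun_on g n f" and "\<And>xs. length xs = n \<Longrightarrow> f xs = h xs"
  shows "rec_fun_on g n h"
  using assms unfolding rec_fun_on_def by fastforce

lemma rec_in_imp_rec_fun_on: "rec_in g n f \<Longrightarrow> rec_fun_on g n f"
  unfolding rec_fun_on_def by blast

lemma rec_fun_on_nth: "i < n \<Longrightarrow> rec_fun_on g n (\<lambda>xs. xs ! i)"
  by (intro rec_in_imp_rec_fun_on rec_in.proj)

lemma rec_fun_on_zero: "rec_fun_on g n (\<lambda>xs. 0)"
  by (intro rec_in_imp_rec_fun_on rec_in.zero)

lemma rec_fun_on_comp: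
  assumes f: "rec_fun_on g m f" and len: "length hs = m" and hs: "\<And>h. h \<in> set hs \<Longrightarrow> rec_fun_on g n h"
  shows "rec_fun_on g n (\<lambda>xs. f (map (\<lambda>h. h xs) hs))"
proof -
  obtain F where F: "rec_in g m F" "\<And>xs. length xs = m \<Longrightarrow> F xs = f xs"
    using f unfolding rec_fun_on_def by blast
  obtain c where c: "\<And>h. h \<in> set hs \<Longrightarrow> rec_in g n (c h) \<and> (\<forall>xs. length xs = n \<longrightarrow> c h xs = h xs)"
    using hs unfolding rec_fun_on_def by metis
  have "rec_in g n (\<lambda>xs. F (map (\<lambda>h. h xs) (map c hs)))"
    using F c len by (intro rec_in.comp[where m=m]) auto
  moreover have "F (map (\<lambda>h. h xs) (map c hs)) = f (map (\<lambda>h. h xs) hs)" if "length xs = n" for xs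
  proof -
    have "map (\<lambda>h. h xs) (map c hs) = map (\<lambda>h. h xs) hs"
      using c that by simp
    then show ?thesis using F(2) len by (simp only: length_map)
  qed
  ultimately show ?thesis unfolding rec_fun_on_def by blast
qed

lemma rec_fun_on_comp1:
  assumes "rec_fun_on g 1 f" "rec_fun_on g n a"
  shows "rec_fun_on g n (\<lambda>xs. f [a xs])"
  using rec_fun_on_comp[OF assms(1), of "[a]" n] assms(2) by simp

lemma rec_fun_on_comp2:
  assumes "rec_fun_on g 2 f" "rec_fun_on g n a" "rec_fun_on g n b"
  shows "rec_fun_on g n (\<lambda>xs. f [a xs, b xs])"
  using rec_fun_on_comp[OF assms(1), of "[a, b]" n] assms(2,3) by auto

lemma rec_fun_on_prim:
  assumes "rec_fun_on g n b" "rec_fun_on g (Suc (Suc n)) s"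
  shows "rec_fun_on g (Suc n) (\<lambda>xs. rec_nat (b (tl xs)) (\<lambda>y r. s (y # r # tl xs)) (hd xs))"
proof -
  obtain B S where B: "rec_in g n B" "\<And>xs. length xs = n \<Longrightarrow> B xs = b xs"
    and S: "rec_in g (Suc (Suc n)) S" "\<And>xs. length xs = Suc (Suc n) \<Longrightarrow> S xs = s xs"
    using assms unfolding rec_fun_on_def by blast
  show ?thesis unfolding rec_fun_on_def
    by (intro exI[of _ "\<lambda>xs. rec_nat (B (tl xs)) (\<lambda>y r. S (y # r # tl xs)) (hd xs)"] conjI
        rec_in.prim B(1) S(1)) (auto simp: B(2) S(2))
qed

lemma rec_fun_on_mu:
  assumes "rec_fun_on g (Suc n) f" and ex: "\<And>xs. length xs = n \<Longrightarrow> \<exists>y. f (y # xs) = 0"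
  shows "rec_fun_on g n (\<lambda>xs. LEAST y. f (y # xs) = 0)"
proof -
  obtain F where F: "rec_in g (Suc n) F" "\<And>xs. length xs = Suc n \<Longrightarrow> F xs = f xs"
    using assms unfolding rec_fun_on_def by blast
  show ?thesis unfolding rec_fun_on_def
    by (intro exI[of _ "\<lambda>xs. LEAST y. F (y # xs) = 0"] conjI rec_in.mu F(1)) (use ex F(2) in auto)
qed

lemma rec_fun_on_Suc: "rec_fun_on g n a \<Longrightarrow> rec_fun_on g n (\<lambda>xs. Suc (a xs))"
  using rec_fun_on_comp1[OF rec_in_imp_rec_fun_on[OF rec_in.succ]] by simp

lemma rec_fun_on_add:
  assumes "rec_fun_on g n a" "rec_fun_on g n b"
  shows "rec_fun_on g n (\<lambda>xs. a xs + b xs)"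
proof -
  have "rec_fun_on g (Suc 1) (\<lambda>xs. rec_nat ((tl xs) ! 0) (\<lambda>y r. Suc ((y # r # tl xs) ! 1)) (hd xs))"
    by (intro rec_fun_on_prim rec_fun_on_Suc rec_fun_on_nth) auto
  moreover have "rec_nat k (\<lambda>y r. Suc r) m = m + k" for k m :: nat
    by (induction m) auto
  ultimately have "rec_fun_on g 2 (\<lambda>xs. xs ! 0 + xs ! 1)"
    unfolding numeral_2_eq_2 One_nat_def by (elim rec_fun_on_cong) (auto simp: length_Suc_conv)
  from rec_fun_on_comp2[OF this assms] show ?thesis by simp
qed

lemma rec_fun_on_pred:
  assumes "rec_fun_on g n a"
  shows "rec_fun_on g n (\<lambda>xs. a xs - 1)"
proof -
  have "rec_fun_on g (Suc 0) (\<lambda>xs. rec_nat 0 (\<lambda>y r. (y # r # tl xs) ! 0) (hd xs))"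
    by (intro rec_fun_on_prim rec_fun_on_zero rec_fun_on_nth) auto
  moreover have "rec_nat 0 (\<lambda>y r. y) m = m - 1" for m :: nat
    by (cases m) auto
  ultimately have "rec_fun_on g 1 (\<lambda>xs. xs ! 0 - 1)"
    unfolding One_nat_def by (elim rec_fun_on_cong) (auto simp: length_Suc_conv)
  from rec_fun_on_comp1[OF this assms] show ?thesis by simp
qed

lemma rec_fun_on_diff:
  assumes "rec_fun_on g n a" "rec_fun_on g n b"
  shows "rec_fun_on g n (\<lambda>xs. a xs - b xs)"
proof -
  \<comment> \<open>Recursion runs along the first argument, which here has to be the subtrahend;
    the final composition swaps the arguments back.\<close>
  have "rec_fun_on g (Suc 1) (\<lambda>xs. rec_nat ((tl xs) ! 0) (\<lambda>y r. (y # r # tl xs) ! 1 - 1) (hd xs))"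
    by (intro rec_fun_on_prim rec_fun_on_pred rec_fun_on_nth) auto
  moreover have "rec_nat k (\<lambda>y r. r - Suc 0) m = k - m" for k m :: nat
    by (induction m) auto
  ultimately have "rec_fun_on g 2 (\<lambda>xs. xs ! 1 - xs ! 0)"
    unfolding numeral_2_eq_2 One_nat_def by (elim rec_fun_on_cong) (auto simp: length_Suc_conv)
  from rec_fun_on_comp2[OF this assms(2,1)] show ?thesis by simp
qed

section \<open>Cantor's pairing function and its inverses\<close>

lemma rec_fun_on_triangle:
  assumes "rec_fun_on g n a"
  shows "rec_fun_on g n (\<lambda>xs. triangle (a xs))"
proof -
  have "rec_fun_on g (Suc 0) (\<lambda>xs. rec_nat 0 (\<lambda>y r. (y # r # tl xs) ! 1 + Suc ((y # r # tl xs) ! 0)) (hd xs))"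
    by (intro rec_fun_on_prim rec_fun_on_zero rec_fun_on_add rec_fun_on_Suc rec_fun_on_nth) auto
  moreover have "rec_nat 0 (\<lambda>y r. Suc (r + y)) m = triangle m" for m :: nat
    by (induction m) auto
  ultimately have "rec_fun_on g 1 (\<lambda>xs. triangle (xs ! 0))"
    unfolding One_nat_def by (elim rec_fun_on_cong) (auto simp: length_Suc_conv)
  from rec_fun_on_comp1[OF this assms] show ?thesis by simp
qed

definition pfst :: "nat \<Rightarrow> nat" where "pfst z = fst (prod_decode z)"
definition psnd :: "nat \<Rightarrow> nat" where "psnd z = snd (prod_decode z)"
abbreviation pair :: "nat \<Rightarrow> nat \<Rightarrow> nat" where "pair a b \<equiv> prod_encode (a, b)"

lemma pfst_pair [simp]: "pfst (pair a b) = a" and psnd_pair [simp]: "psnd (pair a b) = b"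
  by (simp_all add: pfst_def psnd_def)

lemma pair_pfst_psnd [simp]: "pair (pfst z) (psnd z) = z"
  by (simp add: pfst_def psnd_def)

lemma triangle_mono: "m \<le> n \<Longrightarrow> triangle m \<le> triangle n"
  by (induction n) (auto simp: le_Suc_eq)

text \<open>Since \<open>pair a b\<close> is \<open>triangle (a + b) + a\<close>, the sum of the
  components is the least \<open>s\<close> with \<open>z < triangle (Suc s)\<close>. Truncated
  subtraction turns this inequality into an equation with 0, the form that minimisation
  takes.\<close>

lemma Least_triangle: "(LEAST s. Suc z - triangle (Suc s) = 0) = pfst z + psnd z"
proof -
  obtain a b where z: "z = pair a b" by (metis pair_pfst_psnd)
  have "(LEAST s. Suc z - triangle (Suc s) = 0) = a + b"
  proof (rule Least_equality)
    fix s assume s: "Suc z - triangle (Suc s) = 0"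
    show "a + b \<le> s"
    proof (rule ccontr)
      assume "\<not> a + b \<le> s"
      then have "triangle (Suc s) \<le> triangle (a + b)" by (intro triangle_mono) auto
      with s z show False by (auto simp: prod_encode_def)
    qed
  qed (simp add: z prod_encode_def)
  then show ?thesis by (simp add: z)
qed

lemma rec_fun_on_psum:
  assumes "rec_fun_on g n a"
  shows "rec_fun_on g n (\<lambda>xs. pfst (a xs) + psnd (a xs))"
proof -
  have "rec_fun_on g 1 (\<lambda>xs. LEAST s. Suc ((s # xs) ! 1) - triangle (Suc ((s # xs) ! 0)) = 0)"
  proof (rule rec_fun_on_mu)
    show "rec_fun_on g (Suc 1) (\<lambda>a. Suc (a ! 1) - triangle (Suc (a ! 0)))"
      by (intro rec_fun_on_diff rec_fun_on_Suc rec_fun_on_triangle rec_fun_on_nth) auto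
    fix xs :: "nat list"
    have "m \<le> triangle m" for m by (induction m) auto
    from this[of "Suc (xs ! 0)"]
    show "\<exists>y. Suc ((y # xs) ! 1) - triangle (Suc ((y # xs) ! 0)) = 0"
      by (intro exI[of _ "xs ! 0"]) auto
  qed
  then have "rec_fun_on g 1 (\<lambda>xs. pfst (xs ! 0) + psnd (xs ! 0))"
    using Least_triangle by (elim rec_fun_on_cong) simp
  from rec_fun_on_comp1[OF this assms] show ?thesis by simp
qed

lemma rec_fun_on_pfst:
  assumes "rec_fun_on g n a"
  shows "rec_fun_on g n (\<lambda>xs. pfst (a xs))"
proof -
  have "z - triangle (pfst z + psnd z) = pfst z" for z
    using pair_pfst_psnd[of z] unfolding prod_encode_def by simp
  moreover have "rec_fun_on g n (\<lambda>xs. a xs - triangle (pfst (a xs) + psnd (a xs)))"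
    by (intro rec_fun_on_diff rec_fun_on_triangle rec_fun_on_psum assms)
  ultimately show ?thesis by simp
qed

lemma rec_fun_on_psnd:
  assumes "rec_fun_on g n a"
  shows "rec_fun_on g n (\<lambda>xs. psnd (a xs))"
proof -
  have "rec_fun_on g n (\<lambda>xs. (pfst (a xs) + psnd (a xs)) - pfst (a xs))"
    by (intro rec_fun_on_diff rec_fun_on_psum rec_fun_on_pfst assms)
  then show ?thesis by simp
qed

lemma rec_fun_on_pair:
  assumes "rec_fun_on g n a" "rec_fun_on g n b"
  shows "rec_fun_on g n (\<lambda>xs. pair (a xs) (b xs))"
  unfolding prod_encode_def prod.case
  by (intro rec_fun_on_add rec_fun_on_triangle assms)

text \<open>A bound variable \<open>y\<close> in the scope of a parameter \<open>x\<close> is represented by passing to the single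
  argument \<open>p = pair y x\<close>, so all closure rules can be stated for unary functions and predicates.\<close>

definition computable_in :: "(nat \<Rightarrow> nat) \<Rightarrow> (nat \<Rightarrow> nat) \<Rightarrow> bool" where
  "computable_in g f \<longleftrightarrow> rec_fun_on g 1 (\<lambda>xs. f (xs ! 0))"

named_theorems computable_intros

lemma computable_in_lift: "computable_in g f \<Longrightarrow> rec_fun_on g n a \<Longrightarrow> rec_fun_on g n (\<lambda>xs. f (a xs))"
  unfolding computable_in_def using rec_fun_on_comp1 by fastforce

lemma computable_in_comp: "computable_in g f \<Longrightarrow> computable_in g h \<Longrightarrow> computable_in g (\<lambda>x. f (h x))"
  unfolding computable_in_def[of g h] computable_in_def[of g "\<lambda>x. f (h x)"] by (rule computable_in_lift)

lemma computable_in_id [computable_intros]: "computable_in g (\<lambda>x. x)"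
  unfolding computable_in_def by (intro rec_fun_on_nth) simp

lemma computable_in_Suc [computable_intros]: "computable_in g f \<Longrightarrow> computable_in g (\<lambda>x. Suc (f x))"
  unfolding computable_in_def by (intro rec_fun_on_Suc)

lemma computable_in_const [computable_intros]: "computable_in g (\<lambda>x. c)"
  by (induction c) (auto simp: computable_in_def intro: rec_fun_on_Suc rec_fun_on_zero)

lemma computable_in_add [computable_intros]: "computable_in g f \<Longrightarrow> computable_in g h \<Longrightarrow> computable_in g (\<lambda>x. f x + h x)"
  unfolding computable_in_def by (intro rec_fun_on_add)

lemma computable_in_diff [computable_intros]: "computable_in g f \<Longrightarrow> computable_in g h \<Longrightarrow> computable_in g (\<lambda>x. f x - h x)"
  unfolding computable_in_def by (intro rec_fun_on_diff)

lemma computable_in_pair [computable_intros]: "computable_in g f \<Longrightarrow> computable_in g h \<Longrightarrow> computable_in g (\<lambda>x. pair (f x) (h x))"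
  unfolding computable_in_def by (intro rec_fun_on_pair)

lemma computable_in_pfst [computable_intros]: "computable_in g f \<Longrightarrow> computable_in g (\<lambda>x. pfst (f x))"
  unfolding computable_in_def by (intro rec_fun_on_pfst)

lemma computable_in_psnd [computable_intros]: "computable_in g f \<Longrightarrow> computable_in g (\<lambda>x. psnd (f x))"
  unfolding computable_in_def by (intro rec_fun_on_psnd)

lemma computable_in_rec_nat [computable_intros]:
  assumes b: "computable_in g b" and s: "computable_in g (\<lambda>p. s (pfst p) (pfst (psnd p)) (psnd (psnd p)))" and k: "computable_in g k"
  shows "computable_in g (\<lambda>x. rec_nat (b x) (\<lambda>y r. s y r x) (k x))"
proof -
  have "rec_fun_on g 3 (\<lambda>xs. s (xs ! 0) (xs ! 1) (xs ! 2))"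
    using computable_in_lift[OF s, of 3 "\<lambda>xs. pair (xs ! 0) (pair (xs ! 1) (xs ! 2))"]
    by (simp add: rec_fun_on_pair rec_fun_on_nth)
  then have 1: "rec_fun_on g (Suc (Suc 1)) (\<lambda>xs. s (xs ! 0) (xs ! 1) (xs ! 2))"
    by (simp add: numeral_3_eq_3)
  have "rec_fun_on g (Suc 1) (\<lambda>xs. rec_nat (b (tl xs ! 0))
      (\<lambda>y r. s ((y # r # tl xs) ! 0) ((y # r # tl xs) ! 1) ((y # r # tl xs) ! 2)) (hd xs))"
    by (rule rec_fun_on_prim[OF b[unfolded computable_in_def] 1])
  then have "rec_fun_on g 2 (\<lambda>xs. rec_nat (b (tl xs ! 0)) (\<lambda>y r. s y r (tl xs ! 0)) (hd xs))"
    by (simp add: numeral_2_eq_2)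
  from rec_fun_on_comp2[OF this k[unfolded computable_in_def] rec_fun_on_nth[of 0 1 g]]
  show ?thesis unfolding computable_in_def by simp
qed

lemma computable_in_Least:
  assumes f: "computable_in g (\<lambda>p. f (pfst p) (psnd p))" and ex: "\<And>x. \<exists>y. f y x = 0"
  shows "computable_in g (\<lambda>x. LEAST y. f y x = 0)"
proof -
  have "rec_fun_on g (Suc 1) (\<lambda>xs. f (xs ! 0) (xs ! 1))"
    using computable_in_lift[OF f, of "Suc 1" "\<lambda>xs. pair (xs ! 0) (xs ! 1)"]
    by (simp add: rec_fun_on_pair rec_fun_on_nth)
  from rec_fun_on_mu[OF this] ex show ?thesis unfolding computable_in_def by simp
qed

lemma computable_in_oracle: "computable_in g g"
  unfolding computable_in_def
  by (rule rec_fun_on_cong[OF rec_in_imp_rec_fun_on[OF rec_in.orac]]) (auto simp: length_Suc_conv)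

section \<open>Predicates decidable in an oracle\<close>

definition decidable_in :: "(nat \<Rightarrow> nat) \<Rightarrow> (nat \<Rightarrow> bool) \<Rightarrow> bool" where
  "decidable_in g P \<longleftrightarrow> computable_in g (\<lambda>x. of_bool (P x))"

lemma computable_in_if_zero: 
  assumes "computable_in g a" "computable_in g b" "computable_in g c" shows "computable_in g (\<lambda>x. if a x = 0 then b x else c x)"
proof -
  \<comment> \<open>Definition by cases is a primitive recursion whose step forgets the previous
    value.\<close>
  have "computable_in g (\<lambda>x. rec_nat (b x) (\<lambda>y r. (\<lambda>y r x. c x) y r x) (a x))"
    by (intro computable_in_rec_nat assms computable_in_comp[OF assms(3)] computable_intros)
  moreover have "rec_nat u (\<lambda>y r. v) m = (if m = 0 then u else v)" for u v m :: nat
    by (cases m) auto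
  ultimately show ?thesis by simp
qed

lemma computable_in_if [computable_intros]: 
  assumes "decidable_in g P" "computable_in g b" "computable_in g c" shows "computable_in g (\<lambda>x. if P x then b x else c x)"
  using computable_in_if_zero[OF assms(1)[unfolded decidable_in_def] assms(3,2)] 
  by (rule back_subst[of "computable_in g"]) auto

lemma decidable_in_subst: "decidable_in g P \<Longrightarrow> computable_in g f \<Longrightarrow> decidable_in g (\<lambda>x. P (f x))"
  unfolding decidable_in_def by (rule computable_in_comp[of g "\<lambda>x. of_bool (P x)"])

lemma decidable_in_subst2:
  assumes "decidable_in g (\<lambda>p. D (pfst p) (psnd p))" "computable_in g a" "computable_in g b"
  shows "decidable_in g (\<lambda>x. D (a x) (b x))"
  using decidable_in_subst[OF assms(1) computable_in_pair[OF assms(2,3)]] by simp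

lemma decidable_in_eq_zero: assumes "computable_in g a" shows "decidable_in g (\<lambda>x. a x = 0)"
  using computable_in_if_zero[OF assms computable_in_const[of g 1] computable_in_const[of g 0]] unfolding decidable_in_def
  by (simp add: of_bool_def)

lemma decidable_in_le [computable_intros]: "computable_in g a \<Longrightarrow> computable_in g b \<Longrightarrow> decidable_in g (\<lambda>x. a x \<le> b x)"
  using decidable_in_eq_zero[OF computable_in_diff[of g a b]] by simp

lemma decidable_in_less [computable_intros]: "computable_in g a \<Longrightarrow> computable_in g b \<Longrightarrow> decidable_in g (\<lambda>x. a x < b x)"
  using decidable_in_le[OF computable_in_Suc[of g a], of b] by (simp add: Suc_le_eq)

lemma decidable_in_not [computable_intros]: "decidable_in g P \<Longrightarrow> decidable_in g (\<lambda>x. \<not> P x)"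
  using decidable_in_eq_zero[of g "\<lambda>x. of_bool (P x)"] unfolding decidable_in_def by simp

lemma decidable_in_disj [computable_intros]: "decidable_in g P \<Longrightarrow> decidable_in g Q \<Longrightarrow> decidable_in g (\<lambda>x. P x \<or> Q x)"
  using decidable_in_not[OF decidable_in_eq_zero[OF computable_in_add[of g "\<lambda>x. of_bool (P x)" "\<lambda>x. of_bool (Q x)"]]]
  unfolding decidable_in_def by simp

lemma decidable_in_conj [computable_intros]: "decidable_in g P \<Longrightarrow> decidable_in g Q \<Longrightarrow> decidable_in g (\<lambda>x. P x \<and> Q x)"
  using decidable_in_not[OF decidable_in_disj[OF decidable_in_not[of g P] decidable_in_not[of g Q]]] by simp

lemma decidable_in_eq [computable_intros]: "computable_in g a \<Longrightarrow> computable_in g b \<Longrightarrow> decidable_in g (\<lambda>x. a x = b x)"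
  using decidable_in_conj[OF decidable_in_le[of g a b] decidable_in_le[of g b a]] by (simp add: order_eq_iff)

lemma decidable_in_all_less [computable_intros]:
  assumes "decidable_in g (\<lambda>p. P (pfst p) (psnd p))" "computable_in g k"
  shows "decidable_in g (\<lambda>x. \<forall>y<k x. P y x)"
proof -
  \<comment> \<open>Recursion on truth values: \<open>r\<close> turns 0 at the first failure and
    stays 0.\<close>
  have "computable_in g (\<lambda>x. rec_nat 1 (\<lambda>y r. (\<lambda>y r x. if r = 0 then 0 else of_bool (P y x)) y r x) (k x))"
    using decidable_in_subst[OF assms(1) computable_in_pair[OF computable_in_pfst[OF computable_in_id] computable_in_psnd[OF computable_in_psnd[OF computable_in_id]]]]
    by (intro computable_in_rec_nat assms(2) computable_intros) (auto simp: decidable_in_def)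
  moreover have "rec_nat 1 (\<lambda>y r. if r = 0 then 0 else of_bool (P y x)) m = (of_bool (\<forall>y<m. P y x) :: nat)" for x m
    by (induction m) (auto simp: less_Suc_eq)
  ultimately show ?thesis unfolding decidable_in_def by simp
qed

lemma decidable_in_ex_less [computable_intros]:
  assumes "decidable_in g (\<lambda>p. P (pfst p) (psnd p))" "computable_in g k"
  shows "decidable_in g (\<lambda>x. \<exists>y<k x. P y x)"
  using decidable_in_not[OF decidable_in_all_less[OF decidable_in_not[OF assms(1)] assms(2)]] by simp

section \<open>Predicates recursively enumerable in an oracle\<close>

definition semidecidable_in :: "(nat \<Rightarrow> nat) \<Rightarrow> (nat \<Rightarrow> bool) \<Rightarrow> bool" where
  "semidecidable_in g P \<longleftrightarrow> (\<exists>D. decidable_in g (\<lambda>p. D (pfst p) (psnd p)) \<and> (\<forall>x. P x \<longleftrightarrow> (\<exists>y. D y x)))"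

named_theorems semidecidable_intros

lemma semidecidable_in_decidable_in: "decidable_in g P \<Longrightarrow> semidecidable_in g P"
  unfolding semidecidable_in_def using decidable_in_subst[OF _ computable_in_psnd[OF computable_in_id]] by (intro exI[of _ "\<lambda>y. P"]) auto

lemma semidecidable_inI: 
  assumes "decidable_in g (\<lambda>p. D (pfst p) (psnd p))" "\<And>x. P x \<longleftrightarrow> (\<exists>y. D y x)" shows "semidecidable_in g P"
  using assms unfolding semidecidable_in_def by blast

lemma semidecidable_in_subst: assumes "semidecidable_in g P" "computable_in g f" shows "semidecidable_in g (\<lambda>x. P (f x))"
proof -
  obtain D where D: "decidable_in g (\<lambda>p. D (pfst p) (psnd p))" "\<And>x. P x \<longleftrightarrow> (\<exists>y. D y x)"
    using assms unfolding semidecidable_in_def by blast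
  have "decidable_in g (\<lambda>p. D (pfst p) (f (psnd p)))"
    by (intro computable_intros decidable_in_subst2[OF D(1)] computable_in_comp[OF assms(2)])
  then show ?thesis using D(2) by (intro semidecidable_inI[where D="\<lambda>y x. D y (f x)"]) auto
qed

lemma semidecidable_in_ex [semidecidable_intros]: assumes "semidecidable_in g (\<lambda>p. P (pfst p) (psnd p))" shows "semidecidable_in g (\<lambda>x. \<exists>y. P y x)"
proof -
  obtain D where D: "decidable_in g (\<lambda>p. D (pfst p) (psnd p))" "\<And>x. P (pfst x) (psnd x) \<longleftrightarrow> (\<exists>y. D y x)"
    using assms unfolding semidecidable_in_def by blast
  show ?thesis
  proof (rule semidecidable_inI[where D="\<lambda>w x. D (pfst w) (pair (psnd w) x)"])
    show "decidable_in g (\<lambda>p. D (pfst (pfst p)) (pair (psnd (pfst p)) (psnd p)))"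
      by (intro computable_intros decidable_in_subst2[OF D(1)])
    show "(\<exists>y. P y x) \<longleftrightarrow> (\<exists>w. D (pfst w) (pair (psnd w) x))" for x
      using D(2)[of "pair _ x"] by (metis pfst_pair psnd_pair)
  qed
qed

lemma semidecidable_in_conj [semidecidable_intros]: assumes "semidecidable_in g P" "semidecidable_in g Q" shows "semidecidable_in g (\<lambda>x. P x \<and> Q x)"
proof -
  obtain D E where D: "decidable_in g (\<lambda>p. D (pfst p) (psnd p))" "\<And>x. P x \<longleftrightarrow> (\<exists>y. D y x)"
    and E: "decidable_in g (\<lambda>p. E (pfst p) (psnd p))" "\<And>x. Q x \<longleftrightarrow> (\<exists>y. E y x)"
    using assms unfolding semidecidable_in_def by blast
  show ?thesis
  proof (rule semidecidable_inI[where D="\<lambda>w x. D (pfst w) x \<and> E (psnd w) x"])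
    show "decidable_in g (\<lambda>p. D (pfst (pfst p)) (psnd p) \<and> E (psnd (pfst p)) (psnd p))"
      by (intro computable_intros decidable_in_subst2[OF D(1)] decidable_in_subst2[OF E(1)])
    show "P x \<and> Q x \<longleftrightarrow> (\<exists>w. D (pfst w) x \<and> E (psnd w) x)" for x
      using D(2) E(2) by (metis pfst_pair psnd_pair)
  qed
qed

lemma semidecidable_in_disj [semidecidable_intros]: assumes "semidecidable_in g P" "semidecidable_in g Q" shows "semidecidable_in g (\<lambda>x. P x \<or> Q x)"
proof -
  obtain D E where D: "decidable_in g (\<lambda>p. D (pfst p) (psnd p))" "\<And>x. P x \<longleftrightarrow> (\<exists>y. D y x)"
    and E: "decidable_in g (\<lambda>p. E (pfst p) (psnd p))" "\<And>x. Q x \<longleftrightarrow> (\<exists>y. E y x)"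
    using assms unfolding semidecidable_in_def by blast
  show ?thesis
    by (rule semidecidable_inI[where D="\<lambda>w x. D w x \<or> E w x"]) (auto intro!: computable_intros D(1) E(1) simp: D(2) E(2))
qed

text \<open>Finitely many witnesses have a common bound, so the bounded universal quantifier moves
  inside the unbounded existential one.\<close>

lemma semidecidable_in_all_less [semidecidable_intros]:
  assumes "semidecidable_in g (\<lambda>p. P (pfst p) (psnd p))" "computable_in g k"
  shows "semidecidable_in g (\<lambda>x. \<forall>y<k x. P y x)"
proof -
  obtain D where D: "decidable_in g (\<lambda>p. D (pfst p) (psnd p))" "\<And>x. P (pfst x) (psnd x) \<longleftrightarrow> (\<exists>y. D y x)"
    using assms unfolding semidecidable_in_def by blast
  have P: "P y x \<longleftrightarrow> (\<exists>w. D w (pair y x))" for y x using D(2)[of "pair y x"] by simp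
  show ?thesis
  proof (rule semidecidable_inI[where D="\<lambda>w x. \<forall>y<k x. \<exists>v<w. D v (pair y x)"])
    show "decidable_in g (\<lambda>p. \<forall>y<k (psnd p). \<exists>v<pfst p. D v (pair y (psnd p)))"
      by (intro computable_intros decidable_in_subst2[OF D(1)] computable_in_comp[OF assms(2)])
    fix x
    show "(\<forall>y<k x. P y x) \<longleftrightarrow> (\<exists>w. \<forall>y<k x. \<exists>v<w. D v (pair y x))"
    proof
      assume "\<forall>y<k x. P y x"
      then obtain c where c: "\<And>y. y < k x \<Longrightarrow> D (c y) (pair y x)" unfolding P by metis
      have "c y < Suc (Max (c ` {..<k x}))" if "y < k x" for y
        using that by (auto simp: less_Suc_eq_le)
      then show "\<exists>w. \<forall>y<k x. \<exists>v<w. D v (pair y x)" using c by blast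
    qed (auto simp: P)
  qed
qed

lemma semidecidable_in_ex_less [semidecidable_intros]:
  assumes "semidecidable_in g (\<lambda>p. P (pfst p) (psnd p))" "computable_in g k"
  shows "semidecidable_in g (\<lambda>x. \<exists>y<k x. P y x)"
proof -
  have "semidecidable_in g (\<lambda>x. \<exists>y. y < k x \<and> P y x)"
    by (intro semidecidable_intros assms semidecidable_in_decidable_in[OF decidable_in_less] computable_in_comp[OF assms(2)] computable_intros)
  then show ?thesis by simp
qed

text \<open>A search through coded pairs of a value and a witness terminates because
  \<open>f\<close> is total, and any pair it finds carries the right value.\<close>

lemma computable_in_if_semidecidable_in_graph:
  assumes "semidecidable_in g (\<lambda>p. P (pfst p) (psnd p))" and P: "\<And>y x. P y x \<longleftrightarrow> y = f x"
  shows "computable_in g f"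
proof -
  obtain D where D: "decidable_in g (\<lambda>p. D (pfst p) (psnd p))" "\<And>x. P (pfst x) (psnd x) \<longleftrightarrow> (\<exists>y. D y x)"
    using assms unfolding semidecidable_in_def by blast
  have ex: "\<exists>y. D (pfst y) (pair (psnd y) x)" for x
    using D(2)[of "pair (f x) x"] P by (metis pfst_pair psnd_pair)
  have DE: "D w (pair y x) \<Longrightarrow> y = f x" for w y x
    using D(2)[of "pair y x"] P by auto
  have "decidable_in g (\<lambda>p. \<not> D (pfst (pfst p)) (pair (psnd (pfst p)) (psnd p)))"
    by (intro computable_intros decidable_in_subst2[OF D(1)])
  then have "computable_in g (\<lambda>x. LEAST y. (of_bool (\<not> D (pfst y) (pair (psnd y) x)) :: nat) = 0)"
    using ex by (intro computable_in_Least) (auto simp: decidable_in_def)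
  then have "computable_in g (\<lambda>x. psnd (LEAST y. D (pfst y) (pair (psnd y) x)))"
    by (auto intro: computable_intros)
  moreover have "psnd (LEAST y. D (pfst y) (pair (psnd y) x)) = f x" for x
    using LeastI_ex[OF ex] DE by blast
  ultimately show ?thesis by simp
qed

section \<open>Coded lists and finite derivations\<close>

definition pnth :: "nat \<Rightarrow> nat \<Rightarrow> nat" where
  "pnth w i = pfst ((psnd ^^ i) w)"

lemma computable_in_pnth [computable_intros]: assumes "computable_in g a" "computable_in g b" shows "computable_in g (\<lambda>x. pnth (a x) (b x))"
proof -
  have "computable_in g (\<lambda>x. pfst (rec_nat (a x) (\<lambda>y r. (\<lambda>y r x. psnd r) y r x) (b x)))"
    by (intro computable_intros computable_in_rec_nat assms)
  moreover have "rec_nat u (\<lambda>y r. psnd r) m = (psnd ^^ m) u" for u m by (induction m) auto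
  ultimately show ?thesis unfolding pnth_def by simp
qed

text \<open>The code does not determine the length of the list, as \<open>pair 0 0\<close> is 0;
  where the length matters it is supplied separately.\<close>

fun plist :: "nat list \<Rightarrow> nat" where
  "plist [] = 0" | "plist (x # xs) = pair x (plist xs)"

lemma pnth_plist: "i < length xs \<Longrightarrow> pnth (plist xs) i = xs ! i"
proof (induction xs arbitrary: i)
  case (Cons x xs)
  then show ?case
    by (cases i) (auto simp: pnth_def simp del: funpow.simps simp: funpow_Suc_right)
qed simp

text \<open>A common form for the evaluation of programs and for the runs of the decoder, so that
  enumerability is proved once. A rule with one premise is applied with that premise twice.\<close>

inductive derivable :: "(nat \<Rightarrow> bool) \<Rightarrow> (nat \<Rightarrow> nat \<Rightarrow> nat \<Rightarrow> bool) \<Rightarrow> nat \<Rightarrow> bool"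
  for A S where
  axiom: "A t \<Longrightarrow> derivable A S t"
| step: "S t t1 t2 \<Longrightarrow> derivable A S t1 \<Longrightarrow> derivable A S t2 \<Longrightarrow> derivable A S t"

text \<open>The conclusion stands at the head and premises further down the list, so derivations can
  be joined by appending.\<close>

fun derivation :: "(nat \<Rightarrow> bool) \<Rightarrow> (nat \<Rightarrow> nat \<Rightarrow> nat \<Rightarrow> bool) \<Rightarrow> nat list \<Rightarrow> bool" where
  "derivation A S [] \<longleftrightarrow> True"
| "derivation A S (t # l) \<longleftrightarrow> (A t \<or> (\<exists>a\<in>set l. \<exists>b\<in>set l. S t a b)) \<and> derivation A S l"

lemma derivation_append: "derivation A S l \<Longrightarrow> derivation A S m \<Longrightarrow> derivation A S (l @ m)"
  by (induction l) auto

lemma derivable_derivation: "derivable A S t \<Longrightarrow> \<exists>l. derivation A S (t # l)"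
proof (induction rule: derivable.induct)
  case (axiom t)
  then show ?case by (intro exI[of _ "[]"]) auto
next
  case (step t t1 t2)
  then obtain l m where "derivation A S (t1 # l)" "derivation A S (t2 # m)" by blast
  then have "derivation A S ((t1 # l) @ (t2 # m))" by (rule derivation_append)
  then show ?case using step(1) by (intro exI[of _ "(t1 # l) @ (t2 # m)"]) auto
qed

lemma derivation_nth:
  assumes "derivation A S l" "i < length l"
  shows "A (l ! i) \<or> (\<exists>j<length l. \<exists>k<length l. i < j \<and> i < k \<and> S (l ! i) (l ! j) (l ! k))"
  using assms
proof (induction l arbitrary: i)
  case (Cons t l)
  show ?case
  proof (cases i)
    case 0
    show ?thesis
    proof (cases "A t")
      case False
      then obtain j k where "j < length l" "k < length l" "S t (l ! j) (l ! k)"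
        using Cons.prems by (auto simp: in_set_conv_nth)
      then show ?thesis using 0 by (intro disjI2 exI[of _ "Suc j"] exI[of _ "Suc k"] conjI) auto
    qed (use 0 in simp)
  next
    case (Suc i')
    then have "A (l ! i') \<or> (\<exists>j<length l. \<exists>k<length l. i' < j \<and> i' < k \<and> S (l ! i') (l ! j) (l ! k))"
      using Cons by auto
    then show ?thesis
    proof
      assume "\<exists>j<length l. \<exists>k<length l. i' < j \<and> i' < k \<and> S (l ! i') (l ! j) (l ! k)"
      then obtain j k where "j < length l" "k < length l" "i' < j" "i' < k" "S (l ! i') (l ! j) (l ! k)"
        by blast
      then show ?thesis using Suc by (intro disjI2 exI[of _ "Suc j"] exI[of _ "Suc k"] conjI) auto
    qed (use Suc in simp)
  qed
qed simp

text \<open>Arithmetised derivations: \<open>w\<close> codes the list and \<open>m\<close> is its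
  length, which leaves two unbounded quantifiers before bounded ones. Premises sit at larger
  positions, so the converse is an induction on the distance \<open>m - i\<close> to the
  end.\<close>

lemma derivable_iff:
  "derivable A S t \<longleftrightarrow> (\<exists>w m. 0 < m \<and> pnth w 0 = t \<and> (\<forall>i<m. A (pnth w i) \<or>
     (\<exists>j<m. \<exists>k<m. i < j \<and> i < k \<and> S (pnth w i) (pnth w j) (pnth w k))))"
proof
  assume "derivable A S t"
  then obtain l where l: "derivation A S (t # l)" using derivable_derivation by blast
  show "\<exists>w m. 0 < m \<and> pnth w 0 = t \<and> (\<forall>i<m. A (pnth w i) \<or>
     (\<exists>j<m. \<exists>k<m. i < j \<and> i < k \<and> S (pnth w i) (pnth w j) (pnth w k)))"
  proof (rule exI[of _ "plist (t # l)"], rule exI[of _ "length (t # l)"], intro conjI allI impI)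
    fix i assume "i < length (t # l)"
    with derivation_nth[OF l this]
    show "A (pnth (plist (t # l)) i) \<or>
      (\<exists>j<length (t # l). \<exists>k<length (t # l). i < j \<and> i < k \<and>
        S (pnth (plist (t # l)) i) (pnth (plist (t # l)) j) (pnth (plist (t # l)) k))"
      using pnth_plist[of _ "t # l"] by metis
  qed (use pnth_plist[of 0 "t # l"] in auto)
next
  assume "\<exists>w m. 0 < m \<and> pnth w 0 = t \<and> (\<forall>i<m. A (pnth w i) \<or>
     (\<exists>j<m. \<exists>k<m. i < j \<and> i < k \<and> S (pnth w i) (pnth w j) (pnth w k)))"
  then obtain w m where wm: "0 < m" "pnth w 0 = t" "\<And>i. i < m \<Longrightarrow> A (pnth w i) \<or>
     (\<exists>j<m. \<exists>k<m. i < j \<and> i < k \<and> S (pnth w i) (pnth w j) (pnth w k))" by blast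
  have "derivable A S (pnth w i)" if "i < m" for i
    using that
  proof (induction "m - i" arbitrary: i rule: less_induct)
    case less
    have IH: "derivable A S (pnth w j)" if "j < m" "i < j" for j
      using less.hyps[of j] that less.prems by auto
    show ?case using wm(3)[OF less.prems] IH derivable.intros by metis
  qed
  then show "derivable A S t" using wm by blast
qed

lemma semidecidable_in_derivable:
  assumes A: "semidecidable_in g A" and S: "semidecidable_in g (\<lambda>p. S (pfst p) (pfst (psnd p)) (psnd (psnd p)))"
  shows "semidecidable_in g (derivable A S)"
proof -
  have S': "semidecidable_in g (\<lambda>p. S (a p) (b p) (c p))" if "computable_in g a" "computable_in g b" "computable_in g c" for a b c
    using semidecidable_in_subst[OF S, of "\<lambda>p. pair (a p) (pair (b p) (c p))"] that by (simp add: computable_intros)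
  show ?thesis unfolding derivable_iff[abs_def]
    by (intro semidecidable_intros S' semidecidable_in_subst[OF A] computable_intros | rule semidecidable_in_decidable_in)+
qed

section \<open>A universal relation\<close>

text \<open>A program is a pair of an operation number and data. Since programs need not halt,
  evaluation is a relation. Search takes its current candidate as part of the input, so that one
  step of it is a rule with two premises, the most that \<open>derivable\<close> admits.\<close>

inductive eval :: "(nat \<Rightarrow> nat) \<Rightarrow> nat \<Rightarrow> nat \<Rightarrow> nat \<Rightarrow> bool" for G where
  eval_zero: "eval G (pair 0 a) x 0"
| eval_succ: "eval G (pair 1 a) x (Suc x)"
| eval_fst: "eval G (pair 2 a) x (pfst x)"
| eval_snd: "eval G (pair 3 a) x (psnd x)"
| eval_oracle: "eval G (pair 4 a) x (G x)"
| eval_id: "eval G (pair 5 a) x x"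
| eval_comp: "eval G q x w \<Longrightarrow> eval G p w y \<Longrightarrow> eval G (pair 6 (pair p q)) x y"
| eval_pair: "eval G p x u \<Longrightarrow> eval G q x v \<Longrightarrow> eval G (pair 7 (pair p q)) x (pair u v)"
| eval_rec_0: "eval G p x y \<Longrightarrow> eval G (pair 8 (pair p q)) (pair 0 x) y"
| eval_rec_Suc: "eval G (pair 8 (pair p q)) (pair n x) r \<Longrightarrow> eval G q (pair n (pair r x)) y \<Longrightarrow>
    eval G (pair 8 (pair p q)) (pair (Suc n) x) y"
| eval_found: "eval G p (pair n x) 0 \<Longrightarrow> eval G (pair 9 p) (pair n x) n"
| eval_search: "eval G p (pair n x) (Suc m) \<Longrightarrow> eval G (pair 9 p) (pair (Suc n) x) y \<Longrightarrow>
    eval G (pair 9 p) (pair n x) y"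

lemma eval_functional: "eval G e x y \<Longrightarrow> eval G e x z \<Longrightarrow> z = y"
proof (induction arbitrary: z rule: eval.induct)
  case (eval_comp q x w p y)
  from eval_comp.prems obtain w' where "eval G q x w'" "eval G p w' z" 
    by (cases rule: eval.cases) auto
  then show ?case using eval_comp.IH by blast
next
  case (eval_pair p x u q v)
  from eval_pair.prems obtain u' v' where "eval G p x u'" "eval G q x v'" "z = pair u' v'" 
    by (cases rule: eval.cases) auto
  then show ?case using eval_pair.IH by simp
next
  case (eval_rec_0 p x y q)
  from eval_rec_0.prems have "eval G p x z" 
    by (cases rule: eval.cases) auto
  then show ?case using eval_rec_0.IH by blast
next
  case (eval_rec_Suc p q n x r y)
  from eval_rec_Suc.prems obtain r' where "eval G (pair 8 (pair p q)) (pair n x) r'" "eval G q (pair n (pair r' x)) z" 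
    by (cases rule: eval.cases) auto
  then show ?case using eval_rec_Suc.IH by blast
next
  case (eval_found p n x)
  from eval_found.prems show ?case
    by (cases rule: eval.cases) (auto dest: eval_found.IH)
next
  case (eval_search p n x m y)
  from eval_search.prems have "eval G p (pair n x) 0 \<or> eval G (pair 9 p) (pair (Suc n) x) z"
    by (cases rule: eval.cases) auto
  then show ?case using eval_search.IH(1)[of 0] eval_search.IH(2)[of z] by auto
qed (erule eval.cases; simp)+

text \<open>A judgement \<open>eval G e x y\<close> is coded as \<open>pair e (pair x y)\<close>:
  \<open>pfst (pfst t)\<close> is the operation, \<open>pfst (psnd t)\<close> the input and
  \<open>psnd (psnd t)\<close> the output. Writing everything with projections lets the closure
  rules prove decidability.\<close>

definition eval_axiom :: "(nat \<Rightarrow> nat) \<Rightarrow> nat \<Rightarrow> bool" where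
  "eval_axiom G t \<longleftrightarrow>
     pfst (pfst t) = 0 \<and> psnd (psnd t) = 0 \<or>
     pfst (pfst t) = 1 \<and> psnd (psnd t) = Suc (pfst (psnd t)) \<or>
     pfst (pfst t) = 2 \<and> psnd (psnd t) = pfst (pfst (psnd t)) \<or>
     pfst (pfst t) = 3 \<and> psnd (psnd t) = psnd (pfst (psnd t)) \<or>
     pfst (pfst t) = 4 \<and> psnd (psnd t) = G (pfst (psnd t)) \<or>
     pfst (pfst t) = 5 \<and> psnd (psnd t) = pfst (psnd t)"

text \<open>The disjuncts are the rules of \<open>eval\<close> from \<open>eval_comp\<close> to
  \<open>eval_search\<close>, in that order, with \<open>a\<close> and \<open>b\<close> as codes of
  the premises.\<close>

definition eval_rule :: "nat \<Rightarrow> nat \<Rightarrow> nat \<Rightarrow> bool" where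
  "eval_rule t a b \<longleftrightarrow>
     pfst (pfst t) = 6 \<and> pfst a = psnd (psnd (pfst t)) \<and> pfst (psnd a) = pfst (psnd t) \<and>
       pfst b = pfst (psnd (pfst t)) \<and> pfst (psnd b) = psnd (psnd a) \<and> psnd (psnd b) = psnd (psnd t) \<or>
     pfst (pfst t) = 7 \<and> pfst a = pfst (psnd (pfst t)) \<and> pfst (psnd a) = pfst (psnd t) \<and>
       pfst b = psnd (psnd (pfst t)) \<and> pfst (psnd b) = pfst (psnd t) \<and>
       psnd (psnd t) = pair (psnd (psnd a)) (psnd (psnd b)) \<or>
     pfst (pfst t) = 8 \<and> pfst (pfst (psnd t)) = 0 \<and> pfst a = pfst (psnd (pfst t)) \<and>
       pfst (psnd a) = psnd (pfst (psnd t)) \<and> psnd (psnd a) = psnd (psnd t) \<or>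
     pfst (pfst t) = 8 \<and> 0 < pfst (pfst (psnd t)) \<and> pfst a = pfst t \<and>
       pfst (psnd a) = pair (pfst (pfst (psnd t)) - 1) (psnd (pfst (psnd t))) \<and>
       pfst b = psnd (psnd (pfst t)) \<and>
       pfst (psnd b) = pair (pfst (pfst (psnd t)) - 1) (pair (psnd (psnd a)) (psnd (pfst (psnd t)))) \<and>
       psnd (psnd b) = psnd (psnd t) \<or>
     pfst (pfst t) = 9 \<and> pfst a = psnd (pfst t) \<and> pfst (psnd a) = pfst (psnd t) \<and>
       psnd (psnd a) = 0 \<and> psnd (psnd t) = pfst (pfst (psnd t)) \<or>
     pfst (pfst t) = 9 \<and> pfst a = psnd (pfst t) \<and> pfst (psnd a) = pfst (psnd t) \<and>
       0 < psnd (psnd a) \<and> pfst b = pfst t \<and>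
       pfst (psnd b) = pair (Suc (pfst (pfst (psnd t)))) (psnd (pfst (psnd t))) \<and>
       psnd (psnd b) = psnd (psnd t)"

lemma eval_imp_derivable:
  "eval G e x y \<Longrightarrow> derivable (eval_axiom G) eval_rule (pair e (pair x y))"
proof (induction rule: eval.induct)
  case (eval_comp q x w p y)
  then show ?case by (intro derivable.step[OF _ eval_comp.IH]) (simp add: eval_rule_def)
next
  case (eval_pair p x u q v)
  then show ?case by (intro derivable.step[OF _ eval_pair.IH]) (simp add: eval_rule_def)
next
  case (eval_rec_0 p x y q)
  then show ?case by (intro derivable.step[OF _ eval_rec_0.IH eval_rec_0.IH]) (simp add: eval_rule_def)
next
  case (eval_rec_Suc p q n x r y)
  then show ?case by (intro derivable.step[OF _ eval_rec_Suc.IH]) (simp add: eval_rule_def)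
next
  case (eval_found p n x)
  then show ?case by (intro derivable.step[OF _ eval_found.IH eval_found.IH]) (simp add: eval_rule_def)
next
  case (eval_search p n x m y)
  then show ?case by (intro derivable.step[OF _ eval_search.IH]) (simp add: eval_rule_def)
qed (rule derivable.axiom, simp add: eval_axiom_def)+

lemma pair_exhaust3: obtains p a x y where "t = pair (pair p a) (pair x y)"
  by (metis pair_pfst_psnd)

lemma derivable_imp_eval:
  "derivable (eval_axiom G) eval_rule t \<Longrightarrow> eval G (pfst t) (pfst (psnd t)) (psnd (psnd t))"
proof (induction rule: derivable.induct)
  case (axiom t)
  obtain k p x y where t: "t = pair (pair k p) (pair x y)" by (rule pair_exhaust3)
  from axiom show ?case unfolding eval_axiom_def t pfst_pair psnd_pair
    by (elim disjE conjE) (simp_all only: eval.intros(1-6))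
next
  case (step t t1 t2)
  obtain k p q x n y where t: "t = pair (pair k (pair p q)) (pair (pair n x) y)"
    by (metis pair_pfst_psnd)
  obtain e1 x1 y1 where t1: "t1 = pair e1 (pair x1 y1)" by (metis pair_pfst_psnd)
  obtain e2 x2 y2 where t2: "t2 = pair e2 (pair x2 y2)" by (metis pair_pfst_psnd)
  have "eval G e1 x1 y1" "eval G e2 x2 y2" using step.IH by (auto simp: t1 t2)
  with step.hyps(1) show ?case unfolding eval_rule_def t t1 t2 pfst_pair psnd_pair
  proof (elim disjE conjE, goal_cases)
    case 1
    then show ?case using eval_comp[of G q "pair n x" y1 p y] by simp
  next
    case 2
    then show ?case using eval_pair[of G p "pair n x" y1 q y2] by simp
  next
    case 3
    then show ?case using eval_rec_0[of G p x y q] by simp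
  next
    case 4
    then show ?case using eval_rec_Suc[of G p q "n - 1" x y1 y] by simp
  next
    case 5
    then show ?case using eval_found[of G "pair p q" n x] by simp
  next
    case 6
    then show ?case using eval_search[of G "pair p q" n x "y1 - 1" y] by simp
  qed
qed

text \<open>The oracle \<open>G\<close> of the programs may differ from \<open>g\<close>; it only
  has to be computable in it. This allows programs with oracle \<open>c\<close> to be run from any
  \<open>u\<close> above \<open>c\<close>.\<close>

lemma semidecidable_in_eval:
  assumes G: "computable_in g G" and "computable_in g a" "computable_in g b" "computable_in g c"
  shows "semidecidable_in g (\<lambda>p. eval G (a p) (b p) (c p))"
proof -
  have "semidecidable_in g (derivable (eval_axiom G) eval_rule)"
  proof (rule semidecidable_in_derivable)
    show "semidecidable_in g (eval_axiom G)"
      unfolding eval_axiom_def[abs_def] by (rule semidecidable_in_decidable_in, intro computable_intros computable_in_comp[OF G])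
    show "semidecidable_in g (\<lambda>p. eval_rule (pfst p) (pfst (psnd p)) (psnd (psnd p)))"
      unfolding eval_rule_def by (rule semidecidable_in_decidable_in, intro computable_intros)
  qed
  from semidecidable_in_subst[OF this, of "\<lambda>p. pair (a p) (pair (b p) (c p))"]
  have "semidecidable_in g (\<lambda>p. derivable (eval_axiom G) eval_rule (pair (a p) (pair (b p) (c p))))"
    using assms by (simp add: computable_intros)
  moreover have "derivable (eval_axiom G) eval_rule (pair e (pair x y)) \<longleftrightarrow> eval G e x y" for e x y
    using eval_imp_derivable derivable_imp_eval[of G "pair e (pair x y)"] by auto
  ultimately show ?thesis by simp
qed

section \<open>Every function recursive in the oracle has a program\<close>

lemma eval_plist_map:
  assumes "\<And>h. h \<in> set hs \<Longrightarrow> \<exists>e. \<forall>xs. length xs = n \<longrightarrow> eval G e (plist xs) (h xs)"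
  shows "\<exists>e. \<forall>xs. length xs = n \<longrightarrow> eval G e (plist xs) (plist (map (\<lambda>h. h xs) hs))"
  using assms
proof (induction hs)
  case Nil
  then show ?case by (intro exI[of _ "pair 0 0"]) (simp add: eval_zero)
next
  case (Cons h hs)
  obtain e where "\<forall>xs. length xs = n \<longrightarrow> eval G e (plist xs) (h xs)"
    using Cons.prems[of h] by auto
  moreover obtain d where "\<forall>xs. length xs = n \<longrightarrow> eval G d (plist xs) (plist (map (\<lambda>h. h xs) hs))"
    using Cons.IH Cons.prems by auto
  ultimately show ?case
    by (intro exI[of _ "pair 7 (pair e d)"]) (auto intro: eval_pair)
qed

lemma eval_nth: "\<exists>e. \<forall>xs. i < length xs \<longrightarrow> eval G e (plist xs) (xs ! i)"
proof (induction i)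
  case 0
  have "eval G (pair 2 0) (plist xs) (xs ! 0)" if "0 < length xs" for xs
    using that eval_fst[of G 0 "plist xs"] by (cases xs) auto
  then show ?case by blast
next
  case (Suc i)
  then obtain e where e: "\<And>xs. i < length xs \<Longrightarrow> eval G e (plist xs) (xs ! i)" by blast
  have "eval G (pair 6 (pair e (pair 3 0))) (plist xs) (xs ! Suc i)" if "Suc i < length xs" for xs
    using that e[of "tl xs"] eval_snd[of G 0 "plist xs"] by (cases xs) (auto intro: eval_comp)
  then show ?case by blast
qed

lemma eval_search_Least:
  assumes "\<And>y. eval G e (pair y x) (f y)" and "f k = 0"
  shows "eval G (pair 9 e) (pair 0 x) (LEAST y. f y = 0)"
proof -
  define m where "m = (LEAST y. f y = 0)"
  have m: "f m = 0" "\<And>y. y < m \<Longrightarrow> f y \<noteq> 0"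
    using assms(2) LeastI[of "\<lambda>y. f y = 0"] not_less_Least unfolding m_def by blast+
  \<comment> \<open>The induction goes backwards from the least zero \<open>m\<close>, on the number
    of candidates still to be tried.\<close>
  have "eval G (pair 9 e) (pair (m - i) x) m" if "i \<le> m" for i
    using that
  proof (induction i)
    case 0
    then show ?case using assms(1)[of m] m by (auto intro: eval_found)
  next
    case (Suc i)
    then obtain j where "f (m - Suc i) = Suc j" using m(2)[of "m - Suc i"] not0_implies_Suc by force
    then have "eval G e (pair (m - Suc i) x) (Suc j)" using assms(1)[of "m - Suc i"] by simp
    moreover have "eval G (pair 9 e) (pair (Suc (m - Suc i)) x) m" using Suc by (simp add: Suc_diff_Suc)
    ultimately show ?case by (rule eval_search)
  qed
  from this[of m] show ?thesis by (simp add: m_def)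
qed

text \<open>Arguments are passed as one list code. Its nested pairs are exactly the input format of
  the recursion and search programs: \<open>pair k (plist xs)\<close> is
  \<open>plist (k # xs)\<close>.\<close>

lemma rec_in_eval:
  "rec_in G n f \<Longrightarrow> \<exists>e. \<forall>xs. length xs = n \<longrightarrow> eval G e (plist xs) (f xs)"
proof (induction rule: rec_in.induct)
  case (zero n)
  then show ?case using eval_zero by blast
next
  case succ
  have "eval G (pair 6 (pair (pair 1 0) (pair 2 0))) (plist xs) (Suc (hd xs))" if "length xs = 1" for xs
    using that eval_fst[of G 0 "plist xs"] eval_succ[of G 0] 
    by (cases xs) (auto intro: eval_comp)
  then show ?case by blast
next
  case (proj i n)
  then show ?case using eval_nth[of i G] by blast
next
  case orac
  have "eval G (pair 6 (pair (pair 4 0) (pair 2 0))) (plist xs) (G (hd xs))" if "length xs = 1" for xs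
    using that eval_fst[of G 0 "plist xs"] eval_oracle[of G 0] 
    by (cases xs) (auto intro: eval_comp)
  then show ?case by blast
next
  case (comp m f hs n)
  then obtain e where e: "\<And>xs. length xs = m \<Longrightarrow> eval G e (plist xs) (f xs)" by blast
  from comp eval_plist_map[of hs n G] obtain d where
    "\<And>xs. length xs = n \<Longrightarrow> eval G d (plist xs) (plist (map (\<lambda>h. h xs) hs))" by blast
  with e comp.hyps show ?case
    by (intro exI[of _ "pair 6 (pair e d)"]) (auto intro!: eval_comp)
next
  case (prim n b s)
  then obtain e d where e: "\<And>xs. length xs = n \<Longrightarrow> eval G e (plist xs) (b xs)"
    and d: "\<And>xs. length xs = Suc (Suc n) \<Longrightarrow> eval G d (plist xs) (s xs)" by blast
  have "eval G (pair 8 (pair e d)) (pair k (plist xs)) (rec_nat (b xs) (\<lambda>y r. s (y # r # xs)) k)"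
    if "length xs = n" for k xs
  proof (induction k)
    case 0
    then show ?case using e[OF that] by (auto intro: eval_rec_0)
  next
    case (Suc k)
    then show ?case using d[of "k # rec_nat (b xs) (\<lambda>y r. s (y # r # xs)) k # xs"] that
      by (auto intro: eval_rec_Suc)
  qed
  then have "eval G (pair 8 (pair e d)) (plist xs) (rec_nat (b (tl xs)) (\<lambda>y r. s (y # r # tl xs)) (hd xs))"
    if "length xs = Suc n" for xs
    using that by (cases xs) auto
  then show ?case by blast
next
  case (mu n f)
  then obtain e where e: "\<And>xs. length xs = Suc n \<Longrightarrow> eval G e (plist xs) (f xs)" by blast
  have "eval G (pair 6 (pair (pair 9 e) (pair 7 (pair (pair 0 0) (pair 5 0))))) (plist xs)
          (LEAST y. f (y # xs) = 0)" if len: "length xs = n" for xs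
  proof (rule eval_comp)
    show "eval G (pair 7 (pair (pair 0 0) (pair 5 0))) (plist xs) (pair 0 (plist xs))"
      by (intro eval_pair eval_zero eval_id)
    obtain k where "f (k # xs) = 0" using mu.hyps len by blast
    then show "eval G (pair 9 e) (pair 0 (plist xs)) (LEAST y. f (y # xs) = 0)"
      using e len by (intro eval_search_Least) (auto simp flip: plist.simps(2))
  qed
  then show ?case by blast
qed

section \<open>Turing reducibility and its indices\<close>

lemma turing_le_computable_in: "turing_le A B \<longleftrightarrow> computable_in (char_fun B) (char_fun A)"
proof
  assume "turing_le A B"
  then obtain f where f: "rec_in (char_fun B) 1 f" "\<And>n. f [n] = char_fun A n"
    unfolding turing_le_def by blast
  show "computable_in (char_fun B) (char_fun A)" unfolding computable_in_def
    by (rule rec_fun_on_cong[OF rec_in_imp_rec_fun_on[OF f(1)]]) (auto simp: length_Suc_conv f(2))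
next
  assume "computable_in (char_fun B) (char_fun A)"
  then show "turing_le A B" unfolding turing_le_def computable_in_def rec_fun_on_def by force
qed

lemma turing_le_refl: "turing_le A A"
  unfolding turing_le_computable_in by (rule computable_in_oracle)

text \<open>The input \<open>pair n 0\<close> is \<open>plist [n]\<close>, the code of a one-element
  argument list.\<close>

definition computes :: "cantor \<Rightarrow> nat \<Rightarrow> nat \<Rightarrow> nat \<Rightarrow> bool" where
  "computes c e n v \<longleftrightarrow> eval (char_fun c) e (pair n 0) v"

lemma computes_functional: "computes c e n v \<Longrightarrow> computes c e n w \<Longrightarrow> w = v"
  unfolding computes_def by (rule eval_functional)

lemma turing_le_computes: 
  assumes "turing_le a c" shows "\<exists>e. \<forall>n. computes c e n (char_fun a n)"
proof -
  obtain f where f: "rec_in (char_fun c) 1 f" "\<And>n. f [n] = char_fun a n"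
    using assms unfolding turing_le_def by blast
  obtain e where e: "\<And>xs. length xs = 1 \<Longrightarrow> eval (char_fun c) e (plist xs) (f xs)"
    using rec_in_eval[OF f(1)] by blast
  then have "computes c e n (char_fun a n)" for n
    using e[of "[n]"] f(2) unfolding computes_def by simp
  then show ?thesis by blast
qed

lemma semidecidable_in_computes:
  assumes "turing_le c u" "computable_in (char_fun u) a" "computable_in (char_fun u) b" "computable_in (char_fun u) d"
  shows "semidecidable_in (char_fun u) (\<lambda>p. computes c (a p) (b p) (d p))"
  using assms unfolding computes_def turing_le_computable_in by (intro semidecidable_in_eval computable_intros)

section \<open>Coding a real into four members of a perfect set\<close>

definition is_index :: "cantor \<Rightarrow> nat \<Rightarrow> cantor \<Rightarrow> bool" where
  "is_index c e b \<longleftrightarrow> (\<forall>n. computes c e n (char_fun b n))"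

text \<open>Through an index of \<open>b\<close>, agreement and disagreement with \<open>b\<close>
  both become halting facts and hence enumerable: of the two possible bits,
  \<open>1 - char_fun a n\<close> is the one that \<open>a\<close> does not have.\<close>

lemma is_index_computes_iff:
  assumes "is_index c e b"
  shows "computes c e n (char_fun a n) \<longleftrightarrow> a n = b n"
    and "computes c e n (1 - char_fun a n) \<longleftrightarrow> a n \<noteq> b n"
proof -
  have *: "computes c e n v \<longleftrightarrow> v = char_fun b n" for v
    using assms computes_functional unfolding is_index_def by blast
  show "computes c e n (char_fun a n) \<longleftrightarrow> a n = b n"
    and "computes c e n (1 - char_fun a n) \<longleftrightarrow> a n \<noteq> b n"
    unfolding * by (auto simp: char_fun_def)
qed

text \<open>At stage \<open>i\<close> the real \<open>a (j i)\<close> departs at position \<open>k i\<close>, \<open>jp i\<close> is the one that departed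
  before it, and \<open>b i l\<close> is the approximation that \<open>a l\<close> follows after the stage.\<close>

locale coding_stages =
  fixes c :: cantor and z :: cantor and e0 :: nat
    and jp j k :: "nat \<Rightarrow> nat" and b :: "nat \<Rightarrow> nat \<Rightarrow> cantor" and a :: "nat \<Rightarrow> cantor"
  assumes init: "jp 0 = 0" "j 0 = 1" "k 0 = e0" "\<And>l. l < 4 \<Longrightarrow> is_index c e0 (b 0 l)"
    and jp_Suc: "jp (Suc i) = j i"
    and j_less: "j i < 4" "jp i < 4"
    and j_Suc: "j (Suc i) \<noteq> j i" "j (Suc i) \<noteq> jp i"
    and bit: "z i \<longleftrightarrow> (\<exists>m<j (Suc i). m \<noteq> j i \<and> m \<noteq> jp i)"
    and stay: "l < 4 \<Longrightarrow> l \<noteq> j (Suc i) \<Longrightarrow> b (Suc i) l = b i l"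
    and leave_below: "n < k (Suc i) \<Longrightarrow> b (Suc i) (j (Suc i)) n = b i (j (Suc i)) n"
    and leave_at: "b (Suc i) (j (Suc i)) (k (Suc i)) \<noteq> b i (j (Suc i)) (k (Suc i))"
    and bounded_index: "\<exists>e\<le>k i. is_index c e (b i (jp i))"
    and index_test: "e \<le> k i \<Longrightarrow> (\<And>n. n < k (Suc i) \<Longrightarrow> computes c e n (char_fun (b i (jp i)) n)) \<Longrightarrow>
      is_index c e (b i (jp i))"
    and real: "l < 4 \<Longrightarrow> n \<le> k i \<Longrightarrow> a l n = b i l n"
begin

text \<open>The case distinction joins the four reals into one function, computable uniformly in
  \<open>l\<close> from any oracle above all of them.\<close>

definition Z :: "nat \<Rightarrow> nat \<Rightarrow> nat" where
  "Z l n = (if l = 0 then char_fun (a 0) n else if l = 1 then char_fun (a 1) n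
     else if l = 2 then char_fun (a 2) n else char_fun (a 3) n)"

lemma Z_eq: "l < 4 \<Longrightarrow> Z l n = char_fun (a l) n"
  unfolding Z_def by (auto simp: numeral_eq_Suc less_Suc_eq)

lemma real_stay:
  assumes "l < 4" "l \<noteq> j (Suc i)" "n \<le> k (Suc i)" shows "a l n = b i l n"
  using real[of l n "Suc i"] stay[of l i] assms by auto

lemma real_leave:
  shows "n < k (Suc i) \<Longrightarrow> a (j (Suc i)) n = b i (j (Suc i)) n"
    and "a (j (Suc i)) (k (Suc i)) \<noteq> b i (j (Suc i)) (k (Suc i))"
  using real[of "j (Suc i)" _ "Suc i"] j_less[of "Suc i"]
    leave_below[of n i] leave_at[of i] by auto

text \<open>A decoder state after stage \<open>i\<close> codes \<open>(i, jp i, j i, k i, E)\<close>, where \<open>E\<close> codes a list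
  of indices; only those of the two reals other than \<open>jp i\<close> and \<open>j i\<close> are meaningful.\<close>

abbreviation "st_i t \<equiv> pfst t"
abbreviation "st_jp t \<equiv> pfst (psnd t)"
abbreviation "st_j t \<equiv> pfst (psnd (psnd t))"
abbreviation "st_k t \<equiv> pfst (psnd (psnd (psnd t)))"
abbreviation "st_E t \<equiv> psnd (psnd (psnd (psnd t)))"

section \<open>The decoder: guessing and verifying stages\<close>

definition start :: "nat \<Rightarrow> bool" where
  "start t \<longleftrightarrow> t = pair 0 (pair 0 (pair 1 (pair e0 (plist [e0, e0, e0, e0]))))"

text \<open>The new state is guessed and confirmed by halting computations; divergence merely
  withholds confirmation. Of the two reals with known indices, one is seen to depart at
  \<open>st_k t\<close> and the other to stay through that position. The real \<open>st_jp s\<close>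
  receives an index that is at most \<open>st_k s\<close> and is tested below
  \<open>st_k t\<close>.\<close>

definition advance :: "nat \<Rightarrow> nat \<Rightarrow> nat \<Rightarrow> bool" where
  "advance t s r \<longleftrightarrow> st_i t = Suc (st_i s) \<and> st_jp t = st_j s \<and>
     st_j t < 4 \<and> \<not> st_j t = st_j s \<and> \<not> st_j t = st_jp s \<and>
     (\<forall>n<st_k t. computes c (pnth (st_E s) (st_j t)) n (Z (st_j t) n)) \<and>
     computes c (pnth (st_E s) (st_j t)) (st_k t) (1 - Z (st_j t) (st_k t)) \<and>
     (\<forall>l<4. l = st_jp s \<or> l = st_j s \<or> l = st_j t \<or> pnth (st_E t) l = pnth (st_E s) l \<and>
        (\<forall>n<Suc (st_k t). computes c (pnth (st_E s) l) n (Z l n))) \<and>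
     pnth (st_E t) (st_jp s) \<le> st_k s \<and>
     (\<forall>n<st_k t. computes c (pnth (st_E t) (st_jp s)) n (Z (st_jp s) n))"

definition correct :: "nat \<Rightarrow> nat \<Rightarrow> bool" where
  "correct i t \<longleftrightarrow> st_i t = i \<and> st_jp t = jp i \<and> st_j t = j i \<and> st_k t = k i \<and>
     (\<forall>l<4. l \<noteq> jp i \<longrightarrow> l \<noteq> j i \<longrightarrow> is_index c (pnth (st_E t) l) (b i l))"

lemma start_correct: "start t \<Longrightarrow> correct 0 t"
  unfolding start_def correct_def using init pnth_plist[of _ "[e0, e0, e0, e0]"]
  by (auto simp: nth_Cons' numeral_eq_Suc)

text \<open>The checks on the departing and the staying real run through indices known to be right,
  so they force first which real departs and then where. Only then is the test known to be long
  enough for the new index.\<close>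

lemma advance_correct:
  assumes s: "correct i s" and adv: "advance t s r"
  shows "correct (Suc i) t"
proof -
  define J K where "J = j (Suc i)" and "K = k (Suc i)"
  have J: "J < 4" "J \<noteq> j i" "J \<noteq> jp i" using j_less[of "Suc i"] j_Suc unfolding J_def by auto
  have agree: "a l n = b i l n" if "l < 4" "l \<noteq> J" "n \<le> K" for l n
    using real_stay that unfolding J_def K_def by blast
  have leave: "n < K \<Longrightarrow> a J n = b i J n" "a J K \<noteq> b i J K" for n
    using real_leave unfolding J_def K_def by blast+
  have idx: "is_index c (pnth (st_E s) l) (b i l)" if "l < 4" "l \<noteq> jp i" "l \<noteq> j i" for l
    using s that unfolding correct_def by blast
  have s': "st_i s = i" "st_jp s = jp i" "st_j s = j i" "st_k s = k i"
    using s unfolding correct_def by auto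
  have t: "st_i t = Suc i" "st_jp t = j i" "st_j t < 4" "st_j t \<noteq> j i" "st_j t \<noteq> jp i"
    using adv s' unfolding advance_def by auto
  note idx_t = is_index_computes_iff[OF idx[OF t(3) t(5) t(4)]]
  have below: "a (st_j t) n = b i (st_j t) n" if "n < st_k t" for n
    using adv that t(3) unfolding advance_def by (auto simp: Z_eq idx_t)
  have at: "a (st_j t) (st_k t) \<noteq> b i (st_j t) (st_k t)"
    using adv t(3) idx_t(2) unfolding advance_def by (auto simp: Z_eq)
  have other: "pnth (st_E t) l = pnth (st_E s) l" "\<And>n. n \<le> st_k t \<Longrightarrow> a l n = b i l n"
    if "l < 4" "l \<noteq> jp i" "l \<noteq> j i" "l \<noteq> st_j t" for l
    using adv that s' is_index_computes_iff(1)[OF idx[OF that(1-3)]]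
    unfolding advance_def less_Suc_eq_le by (auto simp: Z_eq)
  \<comment> \<open>If the guess named the wrong real, \<open>J\<close> would be the one checked to
    stay, so the guessed position lies before \<open>K\<close>. But up to \<open>K\<close> the named
    real follows its element, so it cannot differ there.\<close>
  have jt: "st_j t = J"
  proof (rule ccontr)
    assume "st_j t \<noteq> J"
    then have "st_k t < K" using other(2)[of J K] J leave(2) by force
    then show False using at agree[OF t(3) \<open>st_j t \<noteq> J\<close>] by auto
  qed
  have kt: "st_k t = K"
    using below[of K] at leave unfolding jt by (metis linorder_neqE_nat)
  \<comment> \<open>The real \<open>jp i\<close> does not depart at this stage and agrees with its
    element below \<open>K\<close>, so testing against the real amounts to testing against the
    element.\<close>
  have "is_index c (pnth (st_E t) (jp i)) (b i (jp i))"
  proof (rule index_test)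
    show "pnth (st_E t) (jp i) \<le> k i" using adv s' unfolding advance_def by auto
    fix n assume "n < k (Suc i)"
    moreover from this have "computes c (pnth (st_E t) (jp i)) n (char_fun (a (jp i)) n)"
      using adv s' kt Z_eq[OF j_less(2)] unfolding advance_def K_def by auto
    ultimately show "computes c (pnth (st_E t) (jp i)) n (char_fun (b i (jp i)) n)"
      using agree[OF j_less(2)[of i], of n] J unfolding char_fun_def K_def by auto
  qed
  then have "is_index c (pnth (st_E t) l) (b i l)" if "l < 4" "l \<noteq> j i" "l \<noteq> J" for l
    using other(1)[of l] idx[of l] that jt by (cases "l = jp i") auto
  then show ?thesis unfolding correct_def jp_Suc
    using t jt kt unfolding J_def K_def by (auto simp: stay)
qed

lemma derivable_correct: "derivable start advance t \<Longrightarrow> correct (st_i t) t"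
proof (induction rule: derivable.induct)
  case (axiom t)
  then show ?case using start_correct unfolding correct_def start_def by fastforce
next
  case (step t t1 t2)
  then have "correct (Suc (st_i t1)) t" using advance_correct by blast
  then show ?case unfolding correct_def by metis
qed

text \<open>The true departures, together with a bounded index for \<open>jp i\<close>, pass every
  check, so the decoder reaches each stage.\<close>

lemma ex_derivable: "\<exists>t. derivable start advance t \<and> st_i t = i"
proof (induction i)
  case 0
  show ?case
    by (intro exI[of _ "pair 0 (pair 0 (pair 1 (pair e0 (plist [e0, e0, e0, e0]))))"] conjI
        derivable.axiom) (simp_all add: start_def)
next
  case (Suc i)
  then obtain s where s: "derivable start advance s" "st_i s = i" by blast
  then have cs: "correct i s" using derivable_correct by blast
  then have s': "st_jp s = jp i" "st_j s = j i" "st_k s = k i" unfolding correct_def by auto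
  obtain e where e: "e \<le> k i" "is_index c e (b i (jp i))" using bounded_index by blast
  \<comment> \<open>Only the entry of \<open>jp i\<close> is renewed; the entries that
    \<open>correct\<close> constrains at stage \<open>i\<close> carry over.\<close>
  define f where "f l = (if l = jp i then e else pnth (st_E s) l)" for l
  define E where "E = plist [f 0, f 1, f 2, f 3]"
  have E: "pnth E l = f l" if "l < 4" for l
    using that pnth_plist[of l "[f 0, f 1, f 2, f 3]"] unfolding E_def
    by (auto simp: numeral_eq_Suc less_Suc_eq)
  define t where "t = pair (Suc i) (pair (j i) (pair (j (Suc i)) (pair (k (Suc i)) E)))"
  have idx: "is_index c (pnth (st_E s) l) (b i l)" if "l < 4" "l \<noteq> jp i" "l \<noteq> j i" for l
    using cs that unfolding correct_def by blast
  have "advance t s s"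
    unfolding advance_def t_def pfst_pair psnd_pair s s'
  proof (intro conjI allI impI)
    fix n assume "n < k (Suc i)"
    then show "computes c (pnth (st_E s) (j (Suc i))) n (Z (j (Suc i)) n)"
      using is_index_computes_iff(1)[OF idx[OF j_less(1) j_Suc(2,1)]] real_leave(1) j_less[of "Suc i"]
      by (auto simp: Z_eq)
  next
    show "computes c (pnth (st_E s) (j (Suc i))) (k (Suc i)) (1 - Z (j (Suc i)) (k (Suc i)))"
      using is_index_computes_iff(2)[OF idx[OF j_less(1) j_Suc(2,1)]] real_leave(2) j_less[of "Suc i"]
      by (auto simp: Z_eq)
  next
    fix l :: nat assume l: "l < 4"
    show "l = jp i \<or> l = j i \<or> l = j (Suc i) \<or> pnth E l = pnth (st_E s) l \<and>
        (\<forall>n<Suc (k (Suc i)). computes c (pnth (st_E s) l) n (Z l n))"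
    proof (cases "l = jp i \<or> l = j i \<or> l = j (Suc i)")
      case False
      then show ?thesis 
        using l E[OF l] is_index_computes_iff(1)[OF idx[OF l]] real_stay[OF l, of i]
        by (auto simp: Z_eq f_def less_Suc_eq_le)
    qed blast
  next
    show "pnth E (jp i) \<le> k i" using E[OF j_less(2)] e by (simp add: f_def)
  next
    fix n assume n: "n < k (Suc i)"
    have "a (jp i) n = b i (jp i) n"
      using real_stay[OF j_less(2), of i i n] j_Suc(2)[of i] n by auto
    then show "computes c (pnth E (jp i)) n (Z (jp i) n)"
      using is_index_computes_iff(1)[OF e(2)] E[OF j_less(2)] by (simp add: f_def Z_eq j_less)
  qed (use j_less j_Suc in auto)
  then show ?case using s by (intro exI[of _ t]) (auto intro: derivable.step simp: t_def)
qed

text \<open>The bit \<open>z i\<close> is read off any derivable states for the stages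
  \<open>i\<close> and \<open>Suc i\<close>. Such states may differ in their lists of indices but
  not in the departures, so the enumerable relation \<open>G\<close> is the graph of
  \<open>z\<close>.\<close>

lemma decode:
  assumes c: "turing_le c u" and a: "\<And>l. l < 4 \<Longrightarrow> turing_le (a l) u"
  shows "turing_le z u"
proof -
  let ?g = "char_fun u"
  have a': "computable_in ?g (char_fun (a l))" if "l < 4" for l using a[OF that] by (simp add: turing_le_computable_in)
  have Z: "computable_in ?g (\<lambda>q. Z (x q) (y q))" if "computable_in ?g x" "computable_in ?g y" for x y
    unfolding Z_def by (intro computable_intros that computable_in_comp[OF a']) simp_all
  note C = semidecidable_in_computes[OF c]
  have "semidecidable_in ?g start" unfolding start_def[abs_def] by (intro computable_intros semidecidable_in_decidable_in)
  moreover have "semidecidable_in ?g (\<lambda>q. advance (pfst q) (pfst (psnd q)) (psnd (psnd q)))"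
    unfolding advance_def by (intro semidecidable_intros C computable_intros Z | rule semidecidable_in_decidable_in)+
  ultimately have semidecidable_in: "semidecidable_in ?g (derivable start advance)" by (rule semidecidable_in_derivable)
  define G where "G v i \<longleftrightarrow> (\<exists>s t. derivable start advance s \<and> derivable start advance t \<and>
    st_i s = i \<and> st_i t = Suc i \<and> (v = 1 \<and> (\<exists>m<st_j t. \<not> m = st_j s \<and> \<not> m = st_jp s) \<or>
      v = 0 \<and> \<not> (\<exists>m<st_j t. \<not> m = st_j s \<and> \<not> m = st_jp s)))" for v i :: nat
  have "semidecidable_in ?g (\<lambda>q. G (pfst q) (psnd q))" unfolding G_def
    by (intro semidecidable_in_ex semidecidable_in_conj semidecidable_in_subst[OF semidecidable_in]; (intro computable_intros | rule semidecidable_in_decidable_in, intro computable_intros))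
  moreover have "G v i \<longleftrightarrow> v = char_fun z i" for v i
  proof -
    have *: "st_j t = j (Suc i)" "st_j s = j i" "st_jp s = jp i"
      if "derivable start advance s" "derivable start advance t" "st_i s = i" "st_i t = Suc i" for s t
      using derivable_correct[OF that(1)] derivable_correct[OF that(2)] that
      unfolding correct_def by auto
    have "G v i \<longleftrightarrow> v = 1 \<and> z i \<or> v = 0 \<and> \<not> z i"
      unfolding G_def bit[of i] using ex_derivable[of i] ex_derivable[of "Suc i"] * by (auto; metis)
    then show ?thesis by (auto simp: char_fun_def)
  qed
  ultimately have "computable_in ?g (char_fun z)" by (rule computable_in_if_semidecidable_in_graph)
  then show ?thesis by (simp add: turing_le_computable_in)
qed

end

section \<open>One stage of the construction\<close>

text \<open>Two of the four numbers remain; taking the larger one codes a true bit, the smaller one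
  a false bit.\<close>

lemma ex_choice:
  fixes x y :: nat
  assumes "x < 4" "y < 4" "x \<noteq> y"
  shows "\<exists>w<4. w \<noteq> y \<and> w \<noteq> x \<and> (b \<longleftrightarrow> (\<exists>m<w. m \<noteq> y \<and> m \<noteq> x))"
proof (cases b)
  case True
  have "\<exists>w<4. w \<noteq> y \<and> w \<noteq> x \<and> (\<exists>m<w. m \<noteq> y \<and> m \<noteq> x)" using assms by presburger
  then show ?thesis using True by blast
next
  case False
  have "\<exists>w<4. w \<noteq> y \<and> w \<noteq> x \<and> \<not> (\<exists>m<w. m \<noteq> y \<and> m \<noteq> x)" using assms by presburger
  then show ?thesis using False by blast
qed

text \<open>Each wrong index fails at some argument, by a wrong value or by divergence, and the
  finitely many indices up to \<open>k\<close> share a bound on these arguments.\<close>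

lemma ex_refutation_bound:
  "\<exists>N. \<forall>e\<le>k. (\<forall>n<N. computes c e n (char_fun b n)) \<longrightarrow> is_index c e b"
proof -
  have "\<exists>N. (\<forall>n<N. computes c e n (char_fun b n)) \<longrightarrow> is_index c e b" for e
    unfolding is_index_def by (meson lessI)
  then obtain N where N: "\<And>e. (\<forall>n<N e. computes c e n (char_fun b n)) \<Longrightarrow> is_index c e b" by metis
  have "N e \<le> Max (N ` {..k})" if "e \<le> k" for e using that by simp
  then show ?thesis using N by (meson order_less_le_trans)
qed

text \<open>A condition \<open>p\<close> is a neighbourhood of a point with image \<open>val p\<close>, so small that the image of
  every point in it agrees with \<open>val p\<close> below \<open>len p\<close>.\<close>

locale perfect_scheme =
  fixes Cd :: "'k set" and val :: "'k \<Rightarrow> cantor" and len :: "'k \<Rightarrow> nat"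
    and le :: "'k \<Rightarrow> 'k \<Rightarrow> bool" and A :: "cantor set"
  assumes nonempty: "Cd \<noteq> {}"
    and le_trans: "le r q \<Longrightarrow> le q p \<Longrightarrow> le r p"
    and split: "p \<in> Cd \<Longrightarrow> \<exists>q\<in>Cd. le q p \<and> val q \<noteq> val p \<and> (\<forall>n<N. val q n = val p n)"
    and shrink: "p \<in> Cd \<Longrightarrow> \<exists>q\<in>Cd. le q p \<and> val q = val p \<and> N \<le> len q"
    and limit: "(\<And>i. P i \<in> Cd) \<Longrightarrow> (\<And>i. le (P (Suc i)) (P i)) \<Longrightarrow> (\<And>N. \<exists>i. N \<le> len (P i)) \<Longrightarrow>
      \<exists>a\<in>A. \<forall>i. \<forall>n<len (P i). a n = val (P i) n"
    and countable_val: "countable (val ` Cd)"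
    and val_in: "val ` Cd \<subseteq> A"
begin

text \<open>Here \<open>y\<close> departed last and \<open>x\<close> before it; both sit out while
  \<open>w\<close> codes the bit. The new position bounds an index for \<open>y\<close> and is long
  enough to refute the wrong indices for \<open>x\<close> up to the old position
  \<open>k\<close>.\<close>

lemma ex_stage:
  fixes x y :: nat and q :: "nat \<Rightarrow> 'k"
  assumes c: "\<And>q. q \<in> Cd \<Longrightarrow> turing_le (val q) c"
    and x: "x < 4" "y < 4" "x \<noteq> y" and q: "\<And>l. l < 4 \<Longrightarrow> q l \<in> Cd"
  shows "\<exists>w k' q'. w < 4 \<and> w \<noteq> y \<and> w \<noteq> x \<and> (b \<longleftrightarrow> (\<exists>m<w. m \<noteq> y \<and> m \<noteq> x)) \<and> k < k' \<and>
    (\<forall>l<4. q' l \<in> Cd \<and> le (q' l) (q l) \<and> k' < len (q' l) \<and> (l \<noteq> w \<longrightarrow> val (q' l) = val (q l))) \<and>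
    (\<forall>n<k'. val (q' w) n = val (q w) n) \<and> val (q' w) k' \<noteq> val (q w) k' \<and>
    (\<exists>e\<le>k'. is_index c e (val (q y))) \<and>
    (\<forall>e\<le>k. (\<forall>n<k'. computes c e n (char_fun (val (q x)) n)) \<longrightarrow> is_index c e (val (q x)))"
proof -
  obtain w where w: "w < 4" "w \<noteq> y" "w \<noteq> x" "b \<longleftrightarrow> (\<exists>m<w. m \<noteq> y \<and> m \<noteq> x)"
    using ex_choice[OF x] by blast
  obtain e where e: "is_index c e (val (q y))"
    using turing_le_computes[OF c[OF q[OF x(2)]]] unfolding is_index_def by blast
  obtain N where N: "\<forall>e\<le>k. (\<forall>n<N. computes c e n (char_fun (val (q x)) n)) \<longrightarrow> is_index c e (val (q x))"
    using ex_refutation_bound by blast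
  \<comment> \<open>The departure has to lie beyond \<open>k\<close>, beyond the index
    \<open>e\<close> and beyond the test bound \<open>N\<close>; agreement up to their sum delays it
    past all three.\<close>
  obtain r where r: "r \<in> Cd" "le r (q w)" "val r \<noteq> val (q w)" "\<forall>n<N + e + Suc k. val r n = val (q w) n"
    using split[OF q[OF w(1)]] by blast
  define k' where "k' = (LEAST n. val r n \<noteq> val (q w) n)"
  have k': "val r k' \<noteq> val (q w) k'" "\<forall>n<k'. val r n = val (q w) n"
    using r(3) LeastI_ex[of "\<lambda>n. val r n \<noteq> val (q w) n"] not_less_Least unfolding k'_def by blast+
  then have ge: "N + e + Suc k \<le> k'" using r(4) by (meson not_le_imp_less)
  \<comment> \<open>Shrinking all four conditions past \<open>k'\<close> makes the limits keep the
    present values through \<open>k'\<close>, the disagreement at \<open>k'\<close>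
    included.\<close>
  have "\<exists>r'. r' \<in> Cd \<and> le r' ((q(w := r)) l) \<and> val r' = val ((q(w := r)) l) \<and> Suc k' \<le> len r'"
    if "l < 4" for l
    using shrink[of "(q(w := r)) l" "Suc k'"] q[OF that] r(1) by auto
  then obtain q' where q': "\<And>l. l < 4 \<Longrightarrow> q' l \<in> Cd \<and> le (q' l) ((q(w := r)) l) \<and>
    val (q' l) = val ((q(w := r)) l) \<and> Suc k' \<le> len (q' l)" by metis
  have "le (q' l) (q l)" if "l < 4" for l
    using q'[OF that] le_trans[OF _ r(2)] by (cases "l = w") auto
  moreover have "val (q' w) = val r" using q'[OF w(1)] by simp
  moreover have "\<exists>e\<le>k'. is_index c e (val (q y))" using e ge by (intro exI[of _ e]) auto
  moreover have "\<forall>e\<le>k. (\<forall>n<k'. computes c e n (char_fun (val (q x)) n)) \<longrightarrow> is_index c e (val (q x))"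
    using N ge by auto
  moreover have "\<forall>l<4. q' l \<in> Cd \<and> k' < len (q' l) \<and> (l \<noteq> w \<longrightarrow> val (q' l) = val (q l))"
    using q' by (auto simp: Suc_le_eq)
  moreover have "k < k'" using ge by auto
  ultimately show ?thesis using w k'
    by (rule_tac exI[of _ w], rule_tac exI[of _ k'], rule_tac exI[of _ q']) simp
qed

theorem cofinal:
  assumes directed: "\<And>C. C \<subseteq> A \<Longrightarrow> countable C \<Longrightarrow> \<exists>u\<in>A. \<forall>a\<in>C. turing_le a u"
  shows "\<exists>u\<in>A. turing_le z u"
proof -
  obtain c where c: "c \<in> A" "\<And>q. q \<in> Cd \<Longrightarrow> turing_le (val q) c"
    using directed[OF val_in countable_val] by blast
  obtain q0 where q0: "q0 \<in> Cd" using nonempty by blast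
  obtain e0 where e0: "is_index c e0 (val q0)"
    using turing_le_computes[OF c(2)[OF q0]] unfolding is_index_def by blast
  \<comment> \<open>Stage 0 is no departure. Its position is set to \<open>e0\<close>, which bounds
    the starting index itself, so the first condition must have length above
    \<open>e0\<close>.\<close>
  obtain q1 where q1: "q1 \<in> Cd" "val q1 = val q0" "Suc e0 \<le> len q1" using shrink[OF q0] by blast
  \<comment> \<open>A state lists the real that departed before last, the one that departed last,
    the current position and the four conditions. At stage 0 the reals 0 and 1 count as
    departed.\<close>
  define good where "good i = (\<lambda>(x, y, k, q :: nat \<Rightarrow> 'k). x < 4 \<and> y < 4 \<and> x \<noteq> y \<and> (\<forall>l<4. q l \<in> Cd \<and> k < len (q l)) \<and>
    (\<exists>e\<le>k. is_index c e (val (q x))) \<and>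
    (i = (0::nat) \<longrightarrow> x = (0::nat) \<and> y = (1::nat) \<and> k = e0 \<and> (\<forall>l<4::nat. q l = q1)))" for i
  define nxt where "nxt i = (\<lambda>(x :: nat, y :: nat, k, q :: nat \<Rightarrow> 'k) (y', w, k', q' :: nat \<Rightarrow> 'k). y' = y \<and> w < 4 \<and> w \<noteq> y \<and> w \<noteq> x \<and>
    (z i \<longleftrightarrow> (\<exists>m<w. m \<noteq> y \<and> m \<noteq> x)) \<and> k < k' \<and>
    (\<forall>l<4. q' l \<in> Cd \<and> le (q' l) (q l) \<and> k' < len (q' l) \<and> (l \<noteq> w \<longrightarrow> val (q' l) = val (q l))) \<and>
    (\<forall>n<k'. val (q' w) n = val (q w) n) \<and> val (q' w) k' \<noteq> val (q w) k' \<and>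
    (\<exists>e\<le>k'. is_index c e (val (q y))) \<and>
    (\<forall>e\<le>k. (\<forall>n<k'. computes c e n (char_fun (val (q x)) n)) \<longrightarrow> is_index c e (val (q x))))"
    for i :: nat
  have "\<exists>S. \<forall>i. good i (S i) \<and> nxt i (S i) (S (Suc i))"
  proof (rule dependent_nat_choice)
    show "\<exists>s. good 0 s"
      using q1 e0 by (intro exI[of _ "(0, 1, e0, \<lambda>_. q1)"]) (auto simp: good_def)
  next
    fix s i assume g: "good i s"
    obtain x y k q where s: "s = (x, y, k, q)" by (metis prod.exhaust)
    have xy: "x < 4" "y < 4" "x \<noteq> y" "\<And>l. l < 4 \<Longrightarrow> q l \<in> Cd"
      using g unfolding good_def s by auto
    from ex_stage[where x=x and y=y and q=q and b="z i" and k=k, OF c(2) xy]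
    obtain w k' q' where n: "nxt i (x, y, k, q) (y, w, k', q')"
      unfolding nxt_def prod.case by blast
    have "good (Suc i) (y, w, k', q')" using n xy unfolding nxt_def good_def by auto
    with n s show "\<exists>s'. good (Suc i) s' \<and> nxt i s s'" by blast
  qed
  then obtain S where S: "\<And>i. good i (S i)" "\<And>i. nxt i (S i) (S (Suc i))" by blast
  define jp j k p where "jp i = fst (S i)" and "j i = fst (snd (S i))" and "k i = fst (snd (snd (S i)))"
    and "p i = snd (snd (snd (S i)))" for i
  have S_eq: "S i = (jp i, j i, k i, p i)" for i by (simp add: jp_def j_def k_def p_def)
  note g = S(1)[unfolded S_eq good_def prod.case] and n = S(2)[unfolded S_eq nxt_def prod.case]
  have k_mono: "i \<le> k i" for i
    by (induction i) (use n in \<open>auto simp: Suc_le_eq intro: le_less_trans\<close>)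
  have "\<exists>a\<in>A. \<forall>i. \<forall>n<len (p i l). a n = val (p i l) n" if l: "l < 4" for l
  proof (rule limit)
    show "p i l \<in> Cd" for i using g l by blast
    show "le (p (Suc i) l) (p i l)" for i using n l by blast
    show "\<exists>i. N \<le> len (p i l)" for N using g[of N] k_mono[of N] l by (meson less_imp_le_nat order_trans)
  qed
  then obtain a where a: "\<And>l. l < 4 \<Longrightarrow> a l \<in> A"
    "\<And>l i n. l < 4 \<Longrightarrow> n < len (p i l) \<Longrightarrow> a l n = val (p i l) n" by metis
  interpret coding_stages c z e0 jp j k "\<lambda>i l. val (p i l)" a
  proof
    show "jp 0 = 0" "j 0 = 1" "k 0 = e0" using g[of 0] by auto
    show "is_index c e0 (val (p 0 l))" if "l < 4" for l using g[of 0] that e0 q1 by simp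
    show "jp (Suc i) = j i" "j i < 4" "jp i < 4" "j (Suc i) \<noteq> j i" "j (Suc i) \<noteq> jp i"
      "z i \<longleftrightarrow> (\<exists>m<j (Suc i). m \<noteq> j i \<and> m \<noteq> jp i)" for i
      using g[of i] n[of i] by auto
    show "\<exists>e\<le>k i. is_index c e (val (p i (jp i)))" for i using g[of i] by blast
    show "val (p (Suc i) l) = val (p i l)" if "l < 4" "l \<noteq> j (Suc i)" for i l using n[of i] that by blast
    show "val (p (Suc i) (j (Suc i))) m = val (p i (j (Suc i))) m" if "m < k (Suc i)" for i m
      using n[of i] that by blast
    show "val (p (Suc i) (j (Suc i))) (k (Suc i)) \<noteq> val (p i (j (Suc i))) (k (Suc i))" for i
      using n[of i] by blast
    show "is_index c e (val (p i (jp i)))"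
      if "e \<le> k i" "\<And>m. m < k (Suc i) \<Longrightarrow> computes c e m (char_fun (val (p i (jp i))) m)" for e i
      using n[of i] that by blast
    show "a l m = val (p i l) m" if "l < 4" "m \<le> k i" for i l m
      using a(2)[of l m i] g[of i] that by auto
  qed
  \<comment> \<open>All five reals lie in \<open>A\<close>, so directedness applies a second time
    and gives one bound from which \<open>z\<close> can be decoded.\<close>
  have "insert c (a ` {..<4}) \<subseteq> A" using a c by auto
  from directed[OF this] obtain u where "u \<in> A" "turing_le c u" "\<And>l. l < 4 \<Longrightarrow> turing_le (a l) u"
    by (auto simp: countable_finite)
  then show ?thesis using decode by blast
qed

end

section \<open>Borel sets as projections of closed sets\<close>

text \<open>The factor \<open>nat \<Rightarrow> nat discrete\<close> is Baire space, so over a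
  Polish space these are the analytic sets.\<close>

definition closed_projection :: "'a::topological_space set \<Rightarrow> bool" where
  "closed_projection S \<longleftrightarrow> (\<exists>C :: ('a \<times> (nat \<Rightarrow> nat discrete)) set. closed C \<and> fst ` C = S)"

lemma closed_projection_closed: "closed S \<Longrightarrow> closed_projection S"
  unfolding closed_projection_def
  by (intro exI[of _ "S \<times> UNIV"]) (auto intro: closed_Times)

lemma continuous_on_reindex:
  "continuous_on UNIV (\<lambda>xw :: 'a::topological_space \<times> (nat \<Rightarrow> 'b::topological_space).
     (fst xw, \<lambda>n. snd xw (\<sigma> n)))"
  by (intro continuous_on_Pair continuous_on_fst continuous_on_id continuous_on_coordinatewise_then_product
      continuous_on_product_then_coordinatewise[OF continuous_on_snd])

text \<open>The first entry of the new witness names one of the sets, and the remaining entries are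
  a witness for that set.\<close>

lemma closed_projection_UN:
  assumes "\<And>n::nat. closed_projection (S n)"
  shows "closed_projection (\<Union>n. S n)"
proof -
  obtain D :: "nat \<Rightarrow> ('a \<times> (nat \<Rightarrow> nat discrete)) set" where D: "\<And>n. closed (D n)" "\<And>n. fst ` D n = S n"
    using assms unfolding closed_projection_def by metis
  define g :: "'a \<times> (nat \<Rightarrow> nat discrete) \<Rightarrow> _" where "g = (\<lambda>xw. (fst xw, \<lambda>n. snd xw (Suc n)))"
  have g: "continuous_on UNIV g" unfolding g_def by (rule continuous_on_reindex)
  define C where "C = {xw. g xw \<in> D (of_discrete (snd xw 0))}"
  \<comment> \<open>The first entry is locally constant, so the complement of \<open>C\<close> is a
    union of open slices.\<close>
  have "open ({xw :: 'a \<times> (nat \<Rightarrow> nat discrete). snd xw 0 = discrete n} \<inter> g -` (- D n))" for n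
  proof (rule open_Int)
    have "continuous_on UNIV (\<lambda>xw :: 'a \<times> (nat \<Rightarrow> nat discrete). snd xw 0)"
      by (intro continuous_on_product_then_coordinatewise[OF continuous_on_snd] continuous_on_id)
    from open_vimage[OF open_discrete[of "{discrete n}"] this]
    show "open {xw :: 'a \<times> (nat \<Rightarrow> nat discrete). snd xw 0 = discrete n}" by (simp add: vimage_def)
    show "open (g -` (- D n))" using D(1) g by (intro open_vimage) auto
  qed
  then have "open (\<Union>n. {xw :: 'a \<times> (nat \<Rightarrow> nat discrete). snd xw 0 = discrete n} \<inter> g -` (- D n))"
    by blast
  also have "(\<Union>n. {xw :: 'a \<times> (nat \<Rightarrow> nat discrete). snd xw 0 = discrete n} \<inter> g -` (- D n)) = - C"
    unfolding C_def by (auto simp: discrete_inverse intro: of_discrete_inverse[symmetric])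
  finally have "closed C" by (simp add: closed_def)
  moreover have "fst ` C = (\<Union>n. S n)"
  proof (intro equalityI subsetI)
    fix x assume "x \<in> fst ` C"
    then obtain w where "(x, \<lambda>n. w (Suc n)) \<in> D (of_discrete (w 0))" unfolding C_def g_def by auto
    then show "x \<in> (\<Union>n. S n)" using D(2) by force
  next
    fix x assume "x \<in> (\<Union>n. S n)"
    then obtain n w where "(x, w) \<in> D n" using D(2) by fastforce
    then have "(x, case_nat (discrete n) w) \<in> C" unfolding C_def g_def by (simp add: discrete_inverse)
    then show "x \<in> fst ` C" by force
  qed
  ultimately show ?thesis unfolding closed_projection_def by blast
qed

text \<open>One sequence codes a witness for every \<open>n\<close>, spread over its entries by the
  pairing function.\<close>

lemma closed_projection_INT:
  assumes "\<And>n::nat. closed_projection (S n)"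
  shows "closed_projection (\<Inter>n. S n)"
proof -
  obtain D :: "nat \<Rightarrow> ('a \<times> (nat \<Rightarrow> nat discrete)) set" where D: "\<And>n. closed (D n)" "\<And>n. fst ` D n = S n"
    using assms unfolding closed_projection_def by metis
  define g :: "nat \<Rightarrow> 'a \<times> (nat \<Rightarrow> nat discrete) \<Rightarrow> _" where
    "g n = (\<lambda>xw. (fst xw, \<lambda>m. snd xw (prod_encode (n, m))))" for n
  have g: "continuous_on UNIV (g n)" for n unfolding g_def by (rule continuous_on_reindex)
  define C where "C = (\<Inter>n. g n -` D n)"
  have "closed C" unfolding C_def using D(1) g by (auto intro: closed_vimage)
  moreover have "fst ` C = (\<Inter>n. S n)"
  proof (intro equalityI subsetI)
    fix x assume "x \<in> fst ` C"
    then show "x \<in> (\<Inter>n. S n)" unfolding C_def g_def using D(2) by force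
  next
    fix x assume "x \<in> (\<Inter>n. S n)"
    then have "\<exists>w. (x, w) \<in> D n" for n using D(2)[of n] by force
    then obtain w where "\<And>n. (x, w n) \<in> D n" by metis
    then have "(x, \<lambda>k. w (fst (prod_decode k)) (snd (prod_decode k))) \<in> C" unfolding C_def g_def by simp
    then show "x \<in> fst ` C" by force
  qed
  ultimately show ?thesis unfolding closed_projection_def by blast
qed

text \<open>An open set in a metric space is a countable union of closed sets: \<open>F n\<close>
  consists of the points at distance at least \<open>1 / real (Suc n)\<close> from the
  complement.\<close>

lemma closed_projection_open:
  fixes S :: "'a::metric_space set"
  assumes "open S" shows "closed_projection S"
proof -
  define F where "F n = - (\<Union>y\<in>-S. ball y (1 / real (Suc n)))" for n
  have "S = (\<Union>n. F n)"
  proof (intro equalityI subsetI)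
    fix x assume "x \<in> S"
    then obtain e where e: "e > 0" "ball x e \<subseteq> S" using assms open_contains_ball by blast
    obtain n where "1 / real (Suc n) < e" using nat_approx_posE[OF e(1)] by auto
    then have "x \<in> F n" unfolding F_def using e(2) by (auto simp: dist_commute subset_eq)
    then show "x \<in> (\<Union>n. F n)" by blast
  next
    fix x assume "x \<in> (\<Union>n. F n)"
    then obtain n where "x \<in> F n" by blast
    then have "x \<notin> ball x (1 / real (Suc n))" if "x \<notin> S" using that unfolding F_def by blast
    then show "x \<in> S" by fastforce
  qed
  moreover have "closed (F n)" for n unfolding F_def by auto
  ultimately show ?thesis using closed_projection_UN[of F] closed_projection_closed by metis
qed

lemma borel_closed_projection:
  fixes S :: "'a::metric_space set"
  assumes "S \<in> sets borel" shows "closed_projection S"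
proof -
  have "S \<in> sigma_sets UNIV {S. open S}" using assms by (simp add: borel_def)
  \<comment> \<open>Projections of closed sets need not be closed under complement, so the induction
    carries each set together with its complement.\<close>
  then have "closed_projection S \<and> closed_projection (- S)"
  proof induction
    case (Basic S)
    then show ?case using closed_projection_open[of S] closed_projection_closed[of "- S"] by auto
  next
    case Empty
    then show ?case by (auto intro: closed_projection_closed)
  next
    case (Compl S)
    then show ?case by (simp add: Compl_eq_Diff_UNIV[symmetric])
  next
    case (Union S)
    then show ?case using closed_projection_UN[of S] closed_projection_INT[of "\<lambda>n. - S n"] by simp
  qed
  then show ?thesis ..
qed

section \<open>Perfect schemes in uncountable analytic sets\<close>

lemma open_cylinder:
  fixes h :: "'a::topological_space \<Rightarrow> cantor"
  assumes "continuous_on UNIV h"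
  shows "open {y. h y n = b}" and "open {y. \<forall>n<N. h y n = h d n}"
proof -
  have *: "open {y. h y n = b}" for n b
  proof -
    have "continuous_on UNIV (\<lambda>y. h y n)"
      using continuous_on_product_then_coordinatewise[OF assms] .
    from open_vimage[OF discrete_topology_class.open_discrete this, of "{b}"] show ?thesis by (simp add: vimage_def)
  qed
  show "open {y. h y n = b}" by (rule *)
  have "{y. \<forall>n<N. h y n = h d n} = (\<Inter>n\<in>{..<N}. {y. h y n = h d n})" by auto
  then show "open {y. \<forall>n<N. h y n = h d n}" using * by (simp add: open_INT)
qed

text \<open>Cantor-Bendixson relative to \<open>h\<close>: deleting every basic open set over which
  \<open>h\<close> has only countably many values on \<open>C\<close> loses countably many values in
  all, since the basis is countable. \<open>D\<close> picks one point from each basic set meeting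
  the kernel.\<close>

lemma ex_condensation_kernel:
  fixes h :: "'a::second_countable_topology \<Rightarrow> 'b"
  assumes "uncountable (h ` C)"
  obtains K D where "D \<subseteq> K" "K \<subseteq> C" "K \<noteq> {}" "countable D"
    "\<And>U. open U \<Longrightarrow> U \<inter> K \<noteq> {} \<Longrightarrow> U \<inter> D \<noteq> {}"
    "\<And>U. open U \<Longrightarrow> U \<inter> K \<noteq> {} \<Longrightarrow> uncountable (h ` (K \<inter> U))"
proof -
  obtain B :: "'a set set" where B: "countable B" "topological_basis B"
    using ex_countable_basis by blast
  define W where "W = \<Union>{U \<in> B. countable (h ` (C \<inter> U))}"
  define K where "K = C - W"
  have "h ` (C \<inter> W) = (\<Union>U\<in>{U \<in> B. countable (h ` (C \<inter> U))}. h ` (C \<inter> U))"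
    unfolding W_def by auto
  moreover have "countable (\<Union>U\<in>{U \<in> B. countable (h ` (C \<inter> U))}. h ` (C \<inter> U))"
    using B(1) by (intro countable_UN) auto
  ultimately have W: "countable (h ` (C \<inter> W))" by simp
  have unc: "uncountable (h ` (K \<inter> U))" if U: "open U" "U \<inter> K \<noteq> {}" for U
  proof
    assume "countable (h ` (K \<inter> U))"
    moreover obtain x where x: "x \<in> U" "x \<in> K" using U by blast
    obtain V where V: "V \<in> B" "x \<in> V" "V \<subseteq> U" using B(2) U(1) x(1) topological_basisE by metis
    \<comment> \<open>If the right side is countable, then \<open>V\<close> is among the deleted
      sets, although it contains the point \<open>x\<close> of the kernel.\<close>
    have "h ` (C \<inter> V) \<subseteq> h ` (K \<inter> U) \<union> h ` (C \<inter> W)" unfolding K_def using V(3) by auto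
    ultimately have "countable (h ` (C \<inter> V))" using W countable_subset by (metis countable_Un)
    then show False using V x unfolding K_def W_def by blast
  qed
  define D where "D = (\<lambda>U. SOME x. x \<in> U \<inter> K) ` {U \<in> B. U \<inter> K \<noteq> {}}"
  have some: "(SOME x. x \<in> U \<inter> K) \<in> U \<inter> K" if "U \<inter> K \<noteq> {}" for U
    using that by (meson all_not_in_conv someI_ex)
  have "U \<inter> D \<noteq> {}" if U: "open U" "U \<inter> K \<noteq> {}" for U
  proof -
    obtain x where x: "x \<in> U" "x \<in> K" using U by blast
    obtain V where V: "V \<in> B" "x \<in> V" "V \<subseteq> U" using B(2) U(1) x(1) topological_basisE by metis
    then have "(SOME x. x \<in> V \<inter> K) \<in> V \<inter> D" using some[of V] x unfolding D_def by blast
    then show ?thesis using V by blast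
  qed
  moreover have "D \<subseteq> K" using some unfolding D_def by blast
  moreover have "countable D" unfolding D_def using B(1) by auto
  moreover have "K \<noteq> {}"
  proof
    assume "K = {}"
    then have "C \<inter> W = C" unfolding K_def by blast
    then show False using W assms by simp
  qed
  moreover have "K \<subseteq> C" unfolding K_def by blast
  ultimately show ?thesis using that unc by blast
qed

section \<open>Balls around points of a dense set as conditions\<close>

definition scheme_le :: "'a::metric_space \<times> real \<times> nat \<Rightarrow> 'a \<times> real \<times> nat \<Rightarrow> bool" where
  "scheme_le = (\<lambda>(d', r', N') (d, r, N). cball d' r' \<subseteq> cball d r)"

text \<open>The bound on the radius ties the size of the ball to the length, so that growing lengths
  force convergence.\<close>

definition scheme_conds :: "('a::metric_space \<Rightarrow> cantor) \<Rightarrow> 'a set \<Rightarrow> 'a set \<Rightarrow> ('a \<times> real \<times> nat) set" where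
  "scheme_conds h C D = {(d, r, N). d \<in> D \<and> 0 < r \<and> r \<le> 1 / real (Suc N) \<and>
     (\<forall>y\<in>C \<inter> cball d r. \<forall>n<N. h y n = h d n)}"

lemma ex_scheme_cond:
  assumes h: "continuous_on UNIV h" and "d \<in> D" and U: "open U" "d \<in> U"
  shows "\<exists>r. (d, r, N) \<in> scheme_conds h C D \<and> cball d r \<subseteq> U"
proof -
  have "open (U \<inter> {y. \<forall>n<N. h y n = h d n})" using U open_cylinder(2)[OF h] by (intro open_Int)
  moreover have "d \<in> U \<inter> {y. \<forall>n<N. h y n = h d n}" using U by simp
  ultimately obtain e where e: "0 < e" "cball d e \<subseteq> U \<inter> {y. \<forall>n<N. h y n = h d n}"
    unfolding open_contains_cball by blast
  define r where "r = min e (1 / real (Suc N))"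
  have "cball d r \<subseteq> cball d e" "0 < r" "r \<le> 1 / real (Suc N)" using e unfolding r_def by auto
  then show ?thesis using e \<open>d \<in> D\<close> unfolding scheme_conds_def by (intro exI[of _ r]) auto
qed

text \<open>Unbounded lengths give arbitrarily small radii, and later centres stay in earlier balls,
  so the centres form a Cauchy sequence. Its limit lies in \<open>C\<close> and in every ball, hence
  its image has all the prescribed values.\<close>

lemma scheme_limit:
  fixes C :: "'a::complete_space set"
  assumes C: "closed C" "D \<subseteq> C" and P: "\<And>i. P i \<in> scheme_conds h C D"
    and le: "\<And>i. scheme_le (P (Suc i)) (P i)" and unb: "\<And>N. \<exists>i. N \<le> snd (snd (P i))"
  shows "\<exists>a\<in>h ` C. \<forall>i. \<forall>n<snd (snd (P i)). a n = h (fst (P i)) n"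
proof -
  define d r N where "d i = fst (P i)" and "r i = fst (snd (P i))" and "N i = snd (snd (P i))" for i
  have P_eq: "P i = (d i, r i, N i)" for i by (simp add: d_def r_def N_def)
  have cond: "d i \<in> D" "0 < r i" "r i \<le> 1 / real (Suc (N i))"
    "\<And>y n. y \<in> C \<Longrightarrow> y \<in> cball (d i) (r i) \<Longrightarrow> n < N i \<Longrightarrow> h y n = h (d i) n" for i
    using P[of i] unfolding P_eq scheme_conds_def by auto
  have "cball (d (Suc i)) (r (Suc i)) \<subseteq> cball (d i) (r i)" for i
    using le[of i] unfolding P_eq scheme_le_def by simp
  then have nest: "cball (d m) (r m) \<subseteq> cball (d i) (r i)" if "i \<le> m" for i m
    using that by (rule lift_Suc_antimono_le[where f="\<lambda>i. cball (d i) (r i)"])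
  have dm: "d m \<in> cball (d i) (r i)" if "i \<le> m" for i m
    using subsetD[OF nest[OF that], of "d m"] cond(2)[of m] by simp
  have "Cauchy d"
  proof (rule metric_CauchyI)
    fix e :: real assume "0 < e"
    then obtain M where M: "1 / real (Suc M) < e / 2" using nat_approx_posE[of "e / 2"] by auto
    obtain i where "M \<le> N i" using unb unfolding P_eq by auto
    then have "1 / real (Suc (N i)) \<le> 1 / real (Suc M)" by (intro divide_left_mono) auto
    then have ri: "r i < e / 2" using cond(3)[of i] M by linarith
    show "\<exists>M. \<forall>m\<ge>M. \<forall>n\<ge>M. dist (d m) (d n) < e"
    proof (intro exI[of _ i] allI impI)
      fix m n assume "i \<le> m" "i \<le> n"
      then have "dist (d i) (d m) < e / 2" "dist (d i) (d n) < e / 2" using dm ri by fastforce+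
      then show "dist (d m) (d n) < e" by (metis dist_commute dist_triangle_half_l)
    qed
  qed
  then obtain y where y: "d \<longlonglongrightarrow> y" using Cauchy_convergent convergent_def by blast
  have "d i \<in> C" for i using C(2) cond(1) by blast
  then have "y \<in> C" by (intro Lim_in_closed_set[OF C(1) _ _ y]) auto
  moreover have "y \<in> cball (d i) (r i)" for i
  proof (rule Lim_in_closed_set[OF closed_cball _ _ y])
    show "\<forall>\<^sub>F m in sequentially. d m \<in> cball (d i) (r i)"
      using dm by (auto simp: eventually_sequentially)
  qed simp
  ultimately show ?thesis using cond(4) by (auto simp: P_eq intro!: bexI[of _ y])
qed

lemma perfect_scheme_of_continuous_image:
  fixes h :: "'a::{complete_space,second_countable_topology} \<Rightarrow> cantor"
  assumes h: "continuous_on UNIV h" and C: "closed C" and unc: "uncountable (h ` C)"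
  shows "\<exists>D. perfect_scheme (scheme_conds h C D) (\<lambda>q. h (fst q)) (\<lambda>q. snd (snd q)) scheme_le (h ` C)"
proof -
  obtain K D where D: "D \<subseteq> K" "K \<subseteq> C" "K \<noteq> {}" "countable D"
    and dense: "\<And>U. open U \<Longrightarrow> U \<inter> K \<noteq> {} \<Longrightarrow> U \<inter> D \<noteq> {}"
    and cond: "\<And>U. open U \<Longrightarrow> U \<inter> K \<noteq> {} \<Longrightarrow> uncountable (h ` (K \<inter> U))"
    using ex_condensation_kernel[OF unc] by metis
  note mk = ex_scheme_cond[OF h, of _ D _ _ C]
  have "perfect_scheme (scheme_conds h C D) (\<lambda>q. h (fst q)) (\<lambda>q. snd (snd q)) scheme_le (h ` C)"
  proof
    obtain d where "d \<in> D" using dense[of UNIV] D(3) by auto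
    then show "scheme_conds h C D \<noteq> {}" using mk[of d UNIV 0] by auto
  next
    fix r q p :: "'a \<times> real \<times> nat"
    assume "scheme_le r q" "scheme_le q p"
    then show "scheme_le r p" unfolding scheme_le_def by (auto split: prod.splits)
  next
    fix p N assume p: "p \<in> scheme_conds h C D"
    obtain d r M where peq: "p = (d, r, M)" by (metis prod.exhaust)
    have dr: "d \<in> D" "0 < r" using p unfolding peq scheme_conds_def by auto
    define U where "U = ball d r \<inter> {y. \<forall>n<N. h y n = h d n}"
    have U: "open U" "d \<in> U" using open_cylinder(2)[OF h] dr unfolding U_def by auto
    \<comment> \<open>Condensation supplies a value of \<open>h\<close> other than
      \<open>h d\<close> arbitrarily close to \<open>d\<close>.\<close>
    have "uncountable (h ` (K \<inter> U))" using cond[OF U(1)] U(2) dr D(1) by blast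
    then obtain y where y: "y \<in> K \<inter> U" "h y \<noteq> h d"
      by (metis (no_types, lifting) countable_empty countable_insert countable_subset image_subsetI insertI1)
    then obtain n where n: "h y n \<noteq> h d n" by blast
    \<comment> \<open>The new centre must lie in \<open>D\<close>. Fixing the one bit at which
      \<open>h y\<close> departs from \<open>h d\<close> is an open requirement, so density provides
      such a centre.\<close>
    have "open (U \<inter> {x. h x n = h y n})" using U open_cylinder(1)[OF h] by (intro open_Int)
    moreover have "(U \<inter> {x. h x n = h y n}) \<inter> K \<noteq> {}" using y by blast
    ultimately have "(U \<inter> {x. h x n = h y n}) \<inter> D \<noteq> {}" by (rule dense)
    then obtain d' where d': "d' \<in> D" "d' \<in> U" "h d' n = h y n" by blast
    obtain r' where r': "(d', r', 0) \<in> scheme_conds h C D" "cball d' r' \<subseteq> U"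
      using mk[OF d'(1) U(1) d'(2)] by blast
    show "\<exists>q\<in>scheme_conds h C D. scheme_le q p \<and> h (fst q) \<noteq> h (fst p) \<and>
        (\<forall>n<N. h (fst q) n = h (fst p) n)"
    proof (intro bexI[OF _ r'(1)] conjI)
      show "scheme_le (d', r', 0) p" using r'(2) unfolding U_def scheme_le_def peq by auto
      show "h (fst (d', r', 0)) \<noteq> h (fst p)" using d'(3) n unfolding peq by auto
      show "\<forall>n<N. h (fst (d', r', 0)) n = h (fst p) n" using d'(2) unfolding U_def peq by auto
    qed
    obtain r'' where "(d, r'', N) \<in> scheme_conds h C D" "cball d r'' \<subseteq> ball d r"
      using mk[OF dr(1) open_ball[of d r]] dr(2) by auto
    then show "\<exists>q\<in>scheme_conds h C D. scheme_le q p \<and> h (fst q) = h (fst p) \<and> N \<le> snd (snd q)"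
      unfolding peq scheme_le_def by (intro bexI[of _ "(d, r'', N)"]) auto
  next
    fix P assume P: "\<And>i. P i \<in> scheme_conds h C D" "\<And>i. scheme_le (P (Suc i)) (P i)"
      "\<And>N. \<exists>i. N \<le> snd (snd (P i))"
    have "D \<subseteq> C" using D(1,2) by blast
    from scheme_limit[OF C this P] show "\<exists>a\<in>h ` C. \<forall>i. \<forall>n<snd (snd (P i)). a n = h (fst (P i)) n" .
  next
    have sub: "(\<lambda>q. h (fst q)) ` scheme_conds h C D \<subseteq> h ` D" unfolding scheme_conds_def by auto
    then show "countable ((\<lambda>q. h (fst q)) ` scheme_conds h C D)"
      by (rule countable_subset) (simp add: D(4))
    show "(\<lambda>q. h (fst q)) ` scheme_conds h C D \<subseteq> h ` C" using sub D(1,2) by blast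
  qed
  then show ?thesis by blast
qed

section \<open>Borel images of Borel sets as continuous images of closed sets\<close>

text \<open>The domain is a copy of Cantor space in a type with a complete metric, as the limit
  argument for schemes requires.\<close>

definition to_cantor :: "(nat \<Rightarrow> bool discrete) \<Rightarrow> cantor" where
  "to_cantor w n = of_discrete (w n)"

lemma to_cantor_discrete: "to_cantor (\<lambda>n. discrete (b n)) = b"
  by (simp add: to_cantor_def fun_eq_iff discrete_inverse)

lemma continuous_on_to_cantor: "continuous_on UNIV to_cantor"
proof (rule continuous_on_coordinatewise_then_product)
  fix n
  have "open ((\<lambda>w. to_cantor w n) -` B)" for B
  proof -
    have "(\<lambda>w. to_cantor w n) -` B = (\<lambda>w. w n) -` (of_discrete -` B)"
      by (auto simp: to_cantor_def)
    also have "open \<dots>"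
      using open_vimage[OF open_discrete, of "\<lambda>w :: nat \<Rightarrow> bool discrete. w n"]
      by (simp add: continuous_on_product_coordinates)
    finally show ?thesis .
  qed
  then show "continuous_on UNIV (\<lambda>w. to_cantor w n)"
    by (simp add: continuous_on_open_vimage)
qed

text \<open>The graph of \<open>f\<close> over \<open>Q\<close> is Borel, hence a projection of a
  closed set. Reading off the second coordinate of the graph is continuous and yields the image of
  \<open>Q\<close>.\<close>

lemma borel_image_continuous_image:
  assumes P: "borel_set P" and Q: "borel_set Q" "Q \<subseteq> P" and f: "borel_fun_on P f"
  shows "\<exists>(C :: (((nat \<Rightarrow> bool discrete) \<times> (nat \<Rightarrow> bool discrete)) \<times> (nat \<Rightarrow> nat discrete)) set) h.
    closed C \<and> continuous_on UNIV h \<and> h ` C = f ` Q"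
proof -
  define T where "T n = {a \<in> Q. f a n}" for n
  have T: "T n \<in> sets borel" for n
  proof -
    have "continuous_on UNIV (\<lambda>b :: cantor. b n)" by (rule continuous_on_product_coordinates)
    from open_vimage[OF discrete_topology_class.open_discrete this, of "{True}"] have "open {b :: cantor. b n}"
      by (simp add: vimage_def)
    then have "f -` {b. b n} \<inter> space (restrict_space borel P) \<in> sets (restrict_space borel P)"
      using f unfolding borel_fun_on_def by (intro measurable_sets) auto
    then have "f -` {b. b n} \<inter> P \<in> sets borel"
      using P by (simp add: borel_set_def space_restrict_space sets_restrict_space_iff)
    then have "Q \<inter> (f -` {b. b n} \<inter> P) \<in> sets borel" using Q by (auto simp: borel_set_def)
    also have "Q \<inter> (f -` {b. b n} \<inter> P) = T n" using Q unfolding T_def by auto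
    finally show ?thesis .
  qed
  define X :: "((nat \<Rightarrow> bool discrete) \<times> (nat \<Rightarrow> bool discrete)) \<Rightarrow> cantor" where "X = (\<lambda>p. to_cantor (fst p))"
  define Y :: "((nat \<Rightarrow> bool discrete) \<times> (nat \<Rightarrow> bool discrete)) \<Rightarrow> cantor" where "Y = (\<lambda>p. to_cantor (snd p))"
  have X: "continuous_on UNIV X" and Y: "continuous_on UNIV Y"
    unfolding X_def Y_def
    by (auto intro!: continuous_on_compose2[OF continuous_on_to_cantor] continuous_on_fst continuous_on_snd continuous_on_id)
  have XB: "X -` B \<in> sets borel" if "B \<in> sets borel" for B
    using measurable_sets[OF borel_measurable_continuous_onI[OF X] that] by simp
  have YB: "{p. Y p n} \<in> sets borel" for n
    using open_cylinder(1)[OF Y, of n True] by auto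
  define S where "S = {p. X p \<in> Q \<and> f (X p) = Y p}"
  \<comment> \<open>Equality of \<open>f (X p)\<close> and \<open>Y p\<close> is checked bit by bit:
    at each \<open>n\<close> both bits are true or both are false.\<close>
  have "S = X -` Q \<inter> (\<Inter>n. (X -` T n \<inter> {p. Y p n}) \<union> (- (X -` T n) \<inter> - {p. Y p n}))"
    unfolding S_def T_def by (auto simp: fun_eq_iff)
  also have "\<dots> \<in> sets borel"
    using Q XB[OF T] YB XB unfolding borel_set_def
    by (intro sets.Int sets.countable_INT' sets.Un borel_comp) auto
  finally obtain C :: "(((nat \<Rightarrow> bool discrete) \<times> (nat \<Rightarrow> bool discrete)) \<times> (nat \<Rightarrow> nat discrete)) set"
    where C: "closed C" "fst ` C = S"
    using borel_closed_projection unfolding closed_projection_def by blast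
  have "(\<lambda>p. Y (fst p)) ` C = Y ` S" using C(2) by (metis image_image)
  also have "Y ` S = f ` Q"
  proof (intro equalityI subsetI)
    fix b assume "b \<in> f ` Q"
    then obtain a where "a \<in> Q" "b = f a" by blast
    then have "(\<lambda>n. discrete (a n), \<lambda>n. discrete (b n)) \<in> S"
      unfolding S_def X_def Y_def by (simp add: to_cantor_discrete)
    then show "b \<in> Y ` S" by (rule rev_image_eqI) (simp add: Y_def to_cantor_discrete)
  next
    fix b assume "b \<in> Y ` S"
    then obtain p where "X p \<in> Q" "b = f (X p)" unfolding S_def by auto
    then show "b \<in> f ` Q" by blast
  qed
  finally have "(\<lambda>p. Y (fst p)) ` C = f ` Q" .
  moreover have "continuous_on UNIV (\<lambda>p. Y (fst p))"
    using Y by (auto intro!: continuous_on_compose2[OF Y] continuous_on_fst continuous_on_id)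
  ultimately show ?thesis using C(1) by blast
qed

section \<open>Contradiction from a Borel embedding\<close>

theorem theorem3p5:
  fixes P Q :: "cantor set" and R :: "(cantor \<times> cantor) set" and x :: cantor
  assumes "borel_set P" and "borel_set2 R" and "partial_order_on P R"
    and "locally_countable P R"
    and "P \<approx> (UNIV :: cantor set)"
    and "Q \<subseteq> P" and "borel_set Q" and "uncountable Q" and "countably_directed R Q"
    and "x \<in> P" and "\<forall>q\<in>Q. (x, q) \<notin> R"
  shows "\<not> (\<exists>f. borel_fun_on P f \<and> (\<forall>a\<in>P. \<forall>b\<in>P. (a, b) \<in> R \<longleftrightarrow> turing_le (f a) (f b)))"
proof
  assume "\<exists>f. borel_fun_on P f \<and> (\<forall>a\<in>P. \<forall>b\<in>P. (a, b) \<in> R \<longleftrightarrow> turing_le (f a) (f b))"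
  then obtain f where f: "borel_fun_on P f"
    and emb: "\<And>a b. a \<in> P \<Longrightarrow> b \<in> P \<Longrightarrow> (a, b) \<in> R \<longleftrightarrow> turing_le (f a) (f b)" by blast
  \<comment> \<open>Points with equal images are below each other, as Turing reducibility is
    reflexive, so antisymmetry identifies them. Injectivity keeps the image uncountable.\<close>
  have "inj_on f Q"
  proof (rule inj_onI)
    fix a b assume ab: "a \<in> Q" "b \<in> Q" "f a = f b"
    then have "(a, b) \<in> R" "(b, a) \<in> R" using emb turing_le_refl \<open>Q \<subseteq> P\<close> by (metis subsetD)+
    then show "a = b" using \<open>partial_order_on P R\<close> unfolding partial_order_on_def antisym_def by blast
  qed
  then have unc: "uncountable (f ` Q)" using \<open>uncountable Q\<close> countable_image_inj_on by blast
  obtain C :: "(((nat \<Rightarrow> bool discrete) \<times> (nat \<Rightarrow> bool discrete)) \<times> (nat \<Rightarrow> nat discrete)) set" and h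
    where C: "closed C" "continuous_on UNIV h" "h ` C = f ` Q"
    using borel_image_continuous_image[OF \<open>borel_set P\<close> \<open>borel_set Q\<close> \<open>Q \<subseteq> P\<close> f] by blast
  obtain D where "perfect_scheme (scheme_conds h C D) (\<lambda>q. h (fst q)) (\<lambda>q. snd (snd q)) scheme_le (f ` Q)"
    using perfect_scheme_of_continuous_image[OF C(2,1)] unc unfolding C(3) by blast
  then have "\<exists>u\<in>f ` Q. turing_le (f x) u"
  proof (rule perfect_scheme.cofinal)
    fix B assume B: "B \<subseteq> f ` Q" "countable B"
    \<comment> \<open>Choosing countably many preimages pulls \<open>B\<close> back into
      \<open>Q\<close>, where directedness applies; \<open>f\<close> then carries the bound
      over.\<close>
    obtain Q' where Q': "Q' \<subseteq> Q" "countable Q'" "B = f ` Q'"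
      using B countable_subset_image[of B f Q] by blast
    have "\<exists>u\<in>Q. \<forall>q\<in>Q'. (q, u) \<in> R"
      using \<open>countably_directed R Q\<close> Q'(1,2) unfolding countably_directed_def by simp
    then obtain u where u: "u \<in> Q" "\<And>q. q \<in> Q' \<Longrightarrow> (q, u) \<in> R" by blast
    show "\<exists>u\<in>f ` Q. \<forall>a\<in>B. turing_le a u"
      using u Q' emb \<open>Q \<subseteq> P\<close> by (intro bexI[of _ "f u"]) (auto simp: subset_iff)
  qed
  then obtain q where "q \<in> Q" "turing_le (f x) (f q)" by blast
  then show False using emb \<open>x \<in> P\<close> \<open>Q \<subseteq> P\<close> \<open>\<forall>q\<in>Q. (x, q) \<notin> R\<close> by blast
qed

end
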